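(* Let $m,n,p,q$ be positive integers, $\mathfrak{g}=\mathfrak{gl}_{m\vert n}$ and $\mathfrak{h}=\mathfrak{gl}_{p\vert q}$ over $\mathbb{K}$, and let $B\in\mathfrak{g}_1$ and $H\in\mathfrak{h}_1$ with $\operatorname{rank}B=r_1\geq1$ and $\operatorname{rank}H=r_2\geq1$. Then $$\mathfrak{g}^{B}_{-1}\simeq\mathfrak{h}^{H}_{-1}\iff r_1=r_2\ \text{ and }\ \{m,n\}=\{p,q\},$$ where $\simeq$ denotes isomorphism of Lie algebras over $\mathbb{K}$ and $\{m,n\}$, $\{p,q\}$ are unordered pairs (i.e. $(p,q)=(m,n)$ or $(p,q)=(n,m)$).
   Context: $\mathbb{K}$ is a field of characteristic zero. $\mathfrak{gl}_{m\vert n}$ is the Lie superalgebra of $(m+n)\times(m+n)$ matrices $\begin{pmatrix} A & B\\ C& D\end{pmatrix}$ over $\mathbb{K}$ ($A$ of size $m\times m$, $B$ of size $m\times n$, $C$ of size $n\times m$, $D$ of size $n\times n$), with even part the block diagonal matrices, odd part the block off-diagonal matrices, and superbracket $[X,Y]=XY-(-1)^{(\deg X)(\deg Y)}YX$ for homogeneous $X,Y$. It is $\mathbb{Z}$-graded, $\mathfrak{g}=\mathfrak{g}_{-1}\oplus\mathfrak{g}_0\oplus\mathfrak{g}_1$, where $\mathfrak{g}_0$ consists of the block diagonal matrices, $\mathfrak{g}_{1}$ of the matrices $\begin{pmatrix}0&\mathbf{b}\\0&0\end{pmatrix}$ and $\mathfrak{g}_{-1}$ of the matrices $\begin{pmatrix}0&0\\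 \mathbf{c}&0\end{pmatrix}$. For $B\in\mathfrak{g}_1$, $\mathfrak{g}^B_{-1}$ denotes the vector space $\mathfrak{g}_{-1}$ with the derived bracket $\llbracket X,Y\rrbracket_B=[X,[B,Y]]$, $X,Y\in\mathfrak{g}_{-1}$; this is a Lie algebra over $\mathbb{K}$. The same notation is used for $\mathfrak{h}=\mathfrak{gl}_{p\vert q}=\mathfrak{h}_{-1}\oplus\mathfrak{h}_0\oplus\mathfrak{h}_1$ and $\mathfrak{h}^H_{-1}$, with $(p,q)$ in place of $(m,n)$. The rank of an element of $\mathfrak{g}_1$ or $\mathfrak{h}_1$ is its matrix rank. *)

theory Defs
  imports "Jordan_Normal_Form.DL_Rank"
begin

section \<open>Lie algebras\<close>

record ('a, 'b) lie_algebra = "('a, 'b) module" +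
  lie_bracket :: "'b \<Rightarrow> 'b \<Rightarrow> 'b"

text \<open>The fields \<open>mult\<close> and \<open>one\<close> inherited from the module record play no role.\<close>

locale lie_algebra = Module.module K L
  for K :: "('a, 'c) ring_scheme" and L :: "('a, 'b, 'd) lie_algebra_scheme" (structure) +
  assumes bracket_closed: "\<lbrakk>x \<in> carrier L; y \<in> carrier L\<rbrakk> \<Longrightarrow> lie_bracket L x y \<in> carrier L"
    and bracket_add_left: "\<lbrakk>x \<in> carrier L; y \<in> carrier L; z \<in> carrier L\<rbrakk> \<Longrightarrow>
      lie_bracket L (x \<oplus> y) z = lie_bracket L x z \<oplus> lie_bracket L y z"
    and bracket_add_right: "\<lbrakk>x \<in> carrier L; y \<in> carrier L; z \<in> carrier L\<rbrakk> \<Longrightarrow>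
      lie_bracket L x (y \<oplus> z) = lie_bracket L x y \<oplus> lie_bracket L x z"
    and bracket_smult_left: "\<lbrakk>a \<in> carrier K; x \<in> carrier L; y \<in> carrier L\<rbrakk> \<Longrightarrow>
      lie_bracket L (a \<odot> x) y = a \<odot> lie_bracket L x y"
    and bracket_smult_right: "\<lbrakk>a \<in> carrier K; x \<in> carrier L; y \<in> carrier L\<rbrakk> \<Longrightarrow>
      lie_bracket L x (a \<odot> y) = a \<odot> lie_bracket L x y"
    and bracket_self: "x \<in> carrier L \<Longrightarrow> lie_bracket L x x = \<zero>"
    and jacobi: "\<lbrakk>x \<in> carrier L; y \<in> carrier L; z \<in> carrier L\<rbrakk> \<Longrightarrow>
      lie_bracket L x (lie_bracket L y z) \<oplus> lie_bracket L y (lie_bracket L z x)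
        \<oplus> lie_bracket L z (lie_bracket L x y) = \<zero>"

definition lie_iso ::
  "('a, 'c) ring_scheme \<Rightarrow> ('a, 'b1, 'c1) lie_algebra_scheme \<Rightarrow> ('a, 'b2, 'c2) lie_algebra_scheme
    \<Rightarrow> ('b1 \<Rightarrow> 'b2) set" where
  "lie_iso K L M = {f \<in> LinearCombinations.module_hom K L M.
     bij_betw f (carrier L) (carrier M) \<and>
     (\<forall>x\<in>carrier L. \<forall>y\<in>carrier L. f (lie_bracket L x y) = lie_bracket M (f x) (f y))}"

definition lie_isomorphic ::
  "('a, 'c) ring_scheme \<Rightarrow> ('a, 'b1, 'c1) lie_algebra_scheme \<Rightarrow> ('a, 'b2, 'c2) lie_algebra_scheme
    \<Rightarrow> bool" where
  "lie_isomorphic K L M \<longleftrightarrow> lie_iso K L M \<noteq> {}"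

section \<open>The Lie superalgebra $\mathfrak{gl}_{m|n}$\<close>

definition gl_even :: "nat \<Rightarrow> nat \<Rightarrow> 'a::field mat set" where
  "gl_even m n = {four_block_mat A (0\<^sub>m m n) (0\<^sub>m n m) D | A D.
     A \<in> carrier_mat m m \<and> D \<in> carrier_mat n n}"

definition gl_odd :: "nat \<Rightarrow> nat \<Rightarrow> 'a::field mat set" where
  "gl_odd m n = {four_block_mat (0\<^sub>m m m) B C (0\<^sub>m n n) | B C.
     B \<in> carrier_mat m n \<and> C \<in> carrier_mat n m}"

text \<open>The components $\mathfrak{g}_1$ and $\mathfrak{g}_{-1}$ of the $\mathbb{Z}$-grading.\<close>

definition gl_pos :: "nat \<Rightarrow> nat \<Rightarrow> 'a::field mat set" where
  "gl_pos m n = {four_block_mat (0\<^sub>m m m) b (0\<^sub>m n m) (0\<^sub>m n n) | b. b \<in> carrier_mat m n}"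

definition gl_neg :: "nat \<Rightarrow> nat \<Rightarrow> 'a::field mat set" where
  "gl_neg m n = {four_block_mat (0\<^sub>m m m) (0\<^sub>m m n) c (0\<^sub>m n n) | c. c \<in> carrier_mat n m}"

definition even_part :: "nat \<Rightarrow> nat \<Rightarrow> 'a::field mat \<Rightarrow> 'a mat" where
  "even_part m n X = mat (m + n) (m + n) (\<lambda>(i, j). if i < m \<longleftrightarrow> j < m then X $$ (i, j) else 0)"

definition odd_part :: "nat \<Rightarrow> nat \<Rightarrow> 'a::field mat \<Rightarrow> 'a mat" where
  "odd_part m n X = mat (m + n) (m + n) (\<lambda>(i, j). if i < m \<longleftrightarrow> j < m then 0 else X $$ (i, j))"

text \<open>The superbracket of homogeneous elements of degrees \<open>d\<close> and \<open>e\<close>, followed by its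
  bilinear extension to all matrices.\<close>

definition homogeneous_superbracket :: "nat \<Rightarrow> nat \<Rightarrow> 'a::field mat \<Rightarrow> 'a mat \<Rightarrow> 'a mat" where
  "homogeneous_superbracket d e X Y = X * Y - (-1) ^ (d * e) \<cdot>\<^sub>m (Y * X)"

definition superbracket :: "nat \<Rightarrow> nat \<Rightarrow> 'a::field mat \<Rightarrow> 'a mat \<Rightarrow> 'a mat" where
  "superbracket m n X Y =
     homogeneous_superbracket 0 0 (even_part m n X) (even_part m n Y) +
     homogeneous_superbracket 0 1 (even_part m n X) (odd_part m n Y) +
     homogeneous_superbracket 1 0 (odd_part m n X) (even_part m n Y) +
     homogeneous_superbracket 1 1 (odd_part m n X) (odd_part m n Y)"

lemma superbracket_homogeneous:
  fixes X Y :: "'a::field mat"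
  shows "\<lbrakk>X \<in> gl_even m n; Y \<in> gl_even m n\<rbrakk> \<Longrightarrow> superbracket m n X Y = X * Y - Y * X"
    and "\<lbrakk>X \<in> gl_even m n; Y \<in> gl_odd m n\<rbrakk> \<Longrightarrow> superbracket m n X Y = X * Y - Y * X"
    and "\<lbrakk>X \<in> gl_odd m n; Y \<in> gl_even m n\<rbrakk> \<Longrightarrow> superbracket m n X Y = X * Y - Y * X"
    and "\<lbrakk>X \<in> gl_odd m n; Y \<in> gl_odd m n\<rbrakk> \<Longrightarrow> superbracket m n X Y = X * Y + Y * X"
proof -
  have ev: "X \<in> carrier_mat (m + n) (m + n) \<and> even_part m n X = X \<and> odd_part m n X = 0\<^sub>m (m + n) (m + n)"
    if "X \<in> gl_even m n" for X :: "'a mat"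
    using that by (auto simp: gl_even_def even_part_def odd_part_def intro!: eq_matI)
  have od: "X \<in> carrier_mat (m + n) (m + n) \<and> odd_part m n X = X \<and> even_part m n X = 0\<^sub>m (m + n) (m + n)"
    if "X \<in> gl_odd m n" for X :: "'a mat"
    using that by (auto simp: gl_odd_def even_part_def odd_part_def intro!: eq_matI)
  show "\<lbrakk>X \<in> gl_even m n; Y \<in> gl_even m n\<rbrakk> \<Longrightarrow> superbracket m n X Y = X * Y - Y * X"
    by (drule ev, drule ev)
      (auto simp: superbracket_def homogeneous_superbracket_def intro!: eq_matI)
  show "\<lbrakk>X \<in> gl_even m n; Y \<in> gl_odd m n\<rbrakk> \<Longrightarrow> superbracket m n X Y = X * Y - Y * X"
    by (drule ev, drule od)
      (auto simp: superbracket_def homogeneous_superbracket_def intro!: eq_matI)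
  show "\<lbrakk>X \<in> gl_odd m n; Y \<in> gl_even m n\<rbrakk> \<Longrightarrow> superbracket m n X Y = X * Y - Y * X"
    by (drule od, drule ev)
      (auto simp: superbracket_def homogeneous_superbracket_def intro!: eq_matI)
  show "\<lbrakk>X \<in> gl_odd m n; Y \<in> gl_odd m n\<rbrakk> \<Longrightarrow> superbracket m n X Y = X * Y + Y * X"
    by (drule od, drule od)
      (auto simp: superbracket_def homogeneous_superbracket_def intro!: eq_matI)
qed

definition derived_bracket :: "nat \<Rightarrow> nat \<Rightarrow> 'a::field mat \<Rightarrow> 'a mat \<Rightarrow> 'a mat \<Rightarrow> 'a mat" where
  "derived_bracket m n B X Y = superbracket m n X (superbracket m n B Y)"

definition derived_lie_algebra :: "nat \<Rightarrow> nat \<Rightarrow> 'a::field mat \<Rightarrow> ('a, 'a mat) lie_algebra" where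
  "derived_lie_algebra m n B =
     \<lparr>carrier = gl_neg m n, mult = (*), one = 1\<^sub>m (m + n), zero = 0\<^sub>m (m + n) (m + n), add = (+),
      smult = (\<cdot>\<^sub>m), lie_bracket = derived_bracket m n B\<rparr>"

abbreviation lower_left :: "nat \<Rightarrow> nat \<Rightarrow> 'a::field mat \<Rightarrow> 'a mat" where
  "lower_left m n c \<equiv> four_block_mat (0\<^sub>m m m) (0\<^sub>m m n) c (0\<^sub>m n n)"

lemma derived_bracket_blocks:
  fixes b c c' :: "'a::field mat"
  assumes b: "b \<in> carrier_mat m n" and c: "c \<in> carrier_mat n m" and c': "c' \<in> carrier_mat n m"
  shows "derived_bracket m n (four_block_mat (0\<^sub>m m m) b (0\<^sub>m n m) (0\<^sub>m n n))
      (lower_left m n c) (lower_left m n c') = lower_left m n (c * b * c' - c' * b * c)"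
proof -
  let ?B = "four_block_mat (0\<^sub>m m m) b (0\<^sub>m n m) (0\<^sub>m n n)"
  let ?E = "four_block_mat (b * c') (0\<^sub>m m n) (0\<^sub>m n m) (c' * b)"
  note mult = mult_four_block_mat[where ?nr1.0 = m and ?n1.0 = m and ?n2.0 = n and ?nr2.0 = n
    and ?nc1.0 = m and ?nc2.0 = n]
  note add = add_four_block_mat[where ?nr1.0 = m and ?nr2.0 = n and ?nc1.0 = m and ?nc2.0 = n]
  have [simp]: "b * c' \<in> carrier_mat m m" "c' * b \<in> carrier_mat n n" "c * b \<in> carrier_mat n n"
      "c' * b * c \<in> carrier_mat n m" "c * b * c' \<in> carrier_mat n m"
    using b c c' by auto
  have oddI: "four_block_mat (0\<^sub>m m m) x y (0\<^sub>m n n) \<in> gl_odd m n"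
    if "x \<in> carrier_mat m n" "y \<in> carrier_mat n m" for x y :: "'a mat"
    unfolding gl_odd_def using that by blast
  have odd: "lower_left m n c \<in> gl_odd m n" "lower_left m n c' \<in> gl_odd m n"
    by (rule oddI; fact c c' zero_carrier_mat)+
  have "?B \<in> gl_odd m n"
    by (rule oddI; fact b zero_carrier_mat)
  then have "superbracket m n ?B (lower_left m n c') =
      ?B * lower_left m n c' + lower_left m n c' * ?B"
    by (rule superbracket_homogeneous(4)) (rule odd)
  also have "?B * lower_left m n c' = four_block_mat (b * c') (0\<^sub>m m n) (0\<^sub>m n m) (0\<^sub>m n n)"
    using b c' by (subst mult) simp_all
  also have "lower_left m n c' * ?B = four_block_mat (0\<^sub>m m m) (0\<^sub>m m n) (0\<^sub>m n m) (c' * b)"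
    using b c' by (subst mult) simp_all
  also have "four_block_mat (b * c') (0\<^sub>m m n) (0\<^sub>m n m) (0\<^sub>m n n) +
      four_block_mat (0\<^sub>m m m) (0\<^sub>m m n) (0\<^sub>m n m) (c' * b) = ?E"
    by (subst add) simp_all
  finally have E: "superbracket m n ?B (lower_left m n c') = ?E" .
  have "?E \<in> gl_even m n"
    unfolding gl_even_def by (rule CollectI, intro exI conjI, rule refl) simp_all
  then have "superbracket m n (lower_left m n c) ?E =
      lower_left m n c * ?E - ?E * lower_left m n c"
    by (rule superbracket_homogeneous(3)[OF odd(1)])
  also have "lower_left m n c * ?E = lower_left m n (c * b * c')"
    using b c c' by (subst mult) simp_all
  also have "?E * lower_left m n c = lower_left m n (c' * b * c)"
    using b c c' by (subst mult) simp_all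
  also have "lower_left m n (c * b * c') - lower_left m n (c' * b * c) =
      lower_left m n (c * b * c' - c' * b * c)"
    using b c c' by (intro eq_matI) auto
  finally show ?thesis
    by (simp add: derived_bracket_def E)
qed

lemma lie_algebra_derived_lie_algebra:
  fixes B :: "'a::field mat"
  assumes B: "B \<in> gl_pos m n"
  shows "lie_algebra class_ring (derived_lie_algebra m n B)"
proof -
  obtain b where b: "b \<in> carrier_mat m n"
    and B_eq: "B = four_block_mat (0\<^sub>m m m) b (0\<^sub>m n m) (0\<^sub>m n n)"
    using B unfolding gl_pos_def mem_Collect_eq by (elim exE conjE)
  let ?ll = "lower_left m n :: 'a mat \<Rightarrow> 'a mat"
  have negE: thesis if "x \<in> gl_neg m n" "\<And>c. c \<in> carrier_mat n m \<Longrightarrow> x = ?ll c \<Longrightarrow> thesis"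
    for x :: "'a mat" and thesis
  proof -
    from that(1) obtain c where "x = ?ll c" "c \<in> carrier_mat n m"
      unfolding gl_neg_def mem_Collect_eq by (elim exE conjE)
    then show thesis
      by (intro that(2))
  qed
  have negI: "?ll c \<in> gl_neg m n" if "c \<in> carrier_mat n m" for c
    using that unfolding gl_neg_def by blast
  have add: "?ll c + ?ll d = ?ll (c + d)"
    if "c \<in> carrier_mat n m" "d \<in> carrier_mat n m" for c d
    using that by (intro eq_matI) auto
  have smult: "a \<cdot>\<^sub>m ?ll c = ?ll (a \<cdot>\<^sub>m c)" if "c \<in> carrier_mat n m" for a c
    using that by (intro eq_matI) auto
  have zero: "0\<^sub>m (m + n) (m + n) = ?ll (0\<^sub>m n m)"
    by (intro eq_matI) auto
  have br: "derived_bracket m n B (?ll c) (?ll d) = ?ll (c * b * d - d * b * c)"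
    if "c \<in> carrier_mat n m" "d \<in> carrier_mat n m" for c d
    using derived_bracket_blocks[OF b that] unfolding B_eq .
  have cring: "cring (class_ring :: 'a ring)"
    by unfold_locales
  have ab_group: "abelian_group (derived_lie_algebra m n B)"
  proof (rule abelian_groupI; simp add: derived_lie_algebra_def)
    show "0\<^sub>m (m + n) (m + n) \<in> (gl_neg m n :: 'a mat set)"
      unfolding zero by (rule negI) simp
  next
    fix x y :: "'a mat" assume "x \<in> gl_neg m n" "y \<in> gl_neg m n"
    then obtain c d where "c \<in> carrier_mat n m" "x = ?ll c" "d \<in> carrier_mat n m" "y = ?ll d"
      by (elim negE)
    then show "x + y \<in> gl_neg m n" and "x + y = y + x"
      by (simp_all add: add negI comm_add_mat[of c n m d])
  next
    fix x y z :: "'a mat" assume "x \<in> gl_neg m n" "y \<in> gl_neg m n" "z \<in> gl_neg m n"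
    then obtain c d e where "c \<in> carrier_mat n m" "x = ?ll c" "d \<in> carrier_mat n m" "y = ?ll d"
        "e \<in> carrier_mat n m" "z = ?ll e"
      by (elim negE)
    then show "x + y + z = x + (y + z)"
      by (simp add: add assoc_add_mat[of c n m d e])
  next
    fix x :: "'a mat" assume "x \<in> gl_neg m n"
    then obtain c where c: "c \<in> carrier_mat n m" "x = ?ll c"
      by (elim negE)
    then show "0\<^sub>m (m + n) (m + n) + x = x"
      by (simp only: zero add left_add_zero_mat zero_carrier_mat)
    have "?ll (- c) + x = 0\<^sub>m (m + n) (m + n)"
      using c by (simp only: zero add uminus_l_inv_mat uminus_carrier_mat)
    then show "\<exists>y\<in>gl_neg m n. y + x = 0\<^sub>m (m + n) (m + n)"
      using negI[of "- c"] c by auto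
  qed
  have "Module.module class_ring (derived_lie_algebra m n B)"
  proof (rule Module.moduleI[OF cring ab_group]; simp add: derived_lie_algebra_def)
    fix a and x :: "'a mat" assume "x \<in> gl_neg m n"
    then obtain c where "c \<in> carrier_mat n m" "x = ?ll c"
      by (elim negE)
    then show "a \<cdot>\<^sub>m x \<in> gl_neg m n"
      by (simp add: smult negI)
  next
    fix a a' and x :: "'a mat" assume "x \<in> gl_neg m n"
    then obtain c where "c \<in> carrier_mat n m" "x = ?ll c"
      by (elim negE)
    then show "(a + a') \<cdot>\<^sub>m x = a \<cdot>\<^sub>m x + a' \<cdot>\<^sub>m x"
      by (simp add: smult add add_smult_distrib_right_mat[of c n m])
  next
    fix a and x y :: "'a mat" assume "x \<in> gl_neg m n" "y \<in> gl_neg m n"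
    then obtain c d where "c \<in> carrier_mat n m" "x = ?ll c" "d \<in> carrier_mat n m" "y = ?ll d"
      by (elim negE)
    then show "a \<cdot>\<^sub>m (x + y) = a \<cdot>\<^sub>m x + a \<cdot>\<^sub>m y"
      by (simp add: smult add add_smult_distrib_left_mat[of c n m])
  next
    fix a a' and x :: "'a mat"
    show "a * a' \<cdot>\<^sub>m x = a \<cdot>\<^sub>m (a' \<cdot>\<^sub>m x)"
      by (intro eq_matI) auto
  next
    fix x :: "'a mat"
    show "1 \<cdot>\<^sub>m x = x"
      by (intro eq_matI) auto
  qed
  moreover have "lie_algebra_axioms class_ring (derived_lie_algebra m n B)"
  proof -
    have tri [simp]: "c * b * d \<in> carrier_mat n m"
      if "c \<in> carrier_mat n m" "d \<in> carrier_mat n m" for c d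
      using that b by auto
    have [simp]: "dim_row b = m" "dim_col b = n"
      using b by auto
    have add_l: "(x + y) * b * z = x * b * z + y * b * z"
      and add_r: "z * b * (x + y) = z * b * x + z * b * y"
      and minus_l: "(x - y) * b * z = x * b * z - y * b * z"
      and minus_r: "z * b * (x - y) = z * b * x - z * b * y"
      and smult_l: "(a \<cdot>\<^sub>m x) * b * z = a \<cdot>\<^sub>m (x * b * z)"
      and smult_r: "z * b * (a \<cdot>\<^sub>m x) = a \<cdot>\<^sub>m (z * b * x)"
      and tri_assoc: "x * b * (y * b * z) = x * b * y * b * z"
      if x: "x \<in> carrier_mat n m" and y: "y \<in> carrier_mat n m" and z: "z \<in> carrier_mat n m"
      for a x y z
    proof -
      have xb: "x * b \<in> carrier_mat n n" and yb: "y * b \<in> carrier_mat n n" and zb: "z * b \<in> carrier_mat n n"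
        using x y z b by auto
      show "(x + y) * b * z = x * b * z + y * b * z"
        by (simp add: add_mult_distrib_mat[OF x y b] add_mult_distrib_mat[OF xb yb z])
      show "z * b * (x + y) = z * b * x + z * b * y"
        by (rule mult_add_distrib_mat[OF zb x y])
      show "(x - y) * b * z = x * b * z - y * b * z"
        by (simp add: minus_mult_distrib_mat[OF x y b] minus_mult_distrib_mat[OF xb yb z])
      show "z * b * (x - y) = z * b * x - z * b * y"
        by (rule mult_minus_distrib_mat[OF zb x y])
      show "(a \<cdot>\<^sub>m x) * b * z = a \<cdot>\<^sub>m (x * b * z)"
        by (simp add: mult_smult_assoc_mat[OF x b] mult_smult_assoc_mat[OF xb z])
      show "z * b * (a \<cdot>\<^sub>m x) = a \<cdot>\<^sub>m (z * b * x)"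
        by (rule mult_smult_distrib[OF zb x])
      show "x * b * (y * b * z) = x * b * y * b * z"
        by (simp only: assoc_mult_mat[OF xb yb z, symmetric] assoc_mult_mat[OF xb y b])
    qed
    let ?k = "\<lambda>c d. c * b * d - d * b * c"
    have k [simp]: "?k c d \<in> carrier_mat n m"
      if "c \<in> carrier_mat n m" "d \<in> carrier_mat n m" for c d
      using that by auto
    have k_add_l: "?k (x + y) z = ?k x z + ?k y z"
      and k_add_r: "?k z (x + y) = ?k z x + ?k z y"
      and k_smult_l: "?k (a \<cdot>\<^sub>m x) z = a \<cdot>\<^sub>m ?k x z"
      and k_smult_r: "?k z (a \<cdot>\<^sub>m x) = a \<cdot>\<^sub>m ?k z x"
      and k_jacobi: "?k x (?k y z) + ?k y (?k z x) + ?k z (?k x y) = 0\<^sub>m n m"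
      if x: "x \<in> carrier_mat n m" and y: "y \<in> carrier_mat n m" and z: "z \<in> carrier_mat n m"
      for a x y z
    proof -
      have sum4: "P + Q - (R + S) = (P - R) + (Q - S)"
        if "P \<in> carrier_mat n m" "Q \<in> carrier_mat n m" "R \<in> carrier_mat n m" "S \<in> carrier_mat n m"
        for P Q R S :: "'a mat"
        using that by (intro eq_matI) auto
      have scale: "a \<cdot>\<^sub>m P - a \<cdot>\<^sub>m Q = a \<cdot>\<^sub>m (P - Q)"
        if "P \<in> carrier_mat n m" "Q \<in> carrier_mat n m" for P Q :: "'a mat"
        using that by (intro eq_matI) (auto simp: algebra_simps)
      show "?k (x + y) z = ?k x z + ?k y z" "?k z (x + y) = ?k z x + ?k z y"
        using x y z by (simp_all only: add_l add_r sum4 tri)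
      show "?k (a \<cdot>\<^sub>m x) z = a \<cdot>\<^sub>m ?k x z" "?k z (a \<cdot>\<^sub>m x) = a \<cdot>\<^sub>m ?k z x"
        using x z by (simp_all only: smult_l[OF x x z] smult_r[OF x x z] scale tri)
      have expand: "?k x (?k y z) = x * b * y * b * z - x * b * z * b * y
          - (y * b * z * b * x - z * b * y * b * x)"
        if "x \<in> carrier_mat n m" "y \<in> carrier_mat n m" "z \<in> carrier_mat n m" for x y z
        using that by (simp only: minus_l minus_r tri tri_assoc)
      have cancel: "(P1 - P2 - (P3 - P4)) + (P3 - P5 - (P6 - P2)) + (P6 - P4 - (P1 - P5)) = 0\<^sub>m n m"
        if "P1 \<in> carrier_mat n m" "P2 \<in> carrier_mat n m" "P3 \<in> carrier_mat n m"
          "P4 \<in> carrier_mat n m" "P5 \<in> carrier_mat n m" "P6 \<in> carrier_mat n m"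
        for P1 P2 P3 P4 P5 P6 :: "'a mat"
        using that by (intro eq_matI) auto
      show "?k x (?k y z) + ?k y (?k z x) + ?k z (?k x y) = 0\<^sub>m n m"
        unfolding expand[OF x y z] expand[OF y z x] expand[OF z x y]
        by (rule cancel) (intro tri x y z)+
    qed
    have k_self: "?k x x = 0\<^sub>m n m" if "x \<in> carrier_mat n m" for x
      using that tri[OF that that] by (intro minus_r_inv_mat)
    let ?L = "derived_lie_algebra m n B"
    have sel: "carrier ?L = gl_neg m n" "add ?L = (+)" "zero ?L = 0\<^sub>m (m + n) (m + n)"
        "smult ?L = (\<cdot>\<^sub>m)" "lie_bracket ?L = derived_bracket m n B"
      by (simp_all add: derived_lie_algebra_def)
    show ?thesis
    proof (unfold_locales; unfold sel)
      fix x y :: "'a mat" assume "x \<in> gl_neg m n" "y \<in> gl_neg m n"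
      then obtain c d where cd: "c \<in> carrier_mat n m" "x = ?ll c" "d \<in> carrier_mat n m" "y = ?ll d"
        by (elim negE)
      then show "derived_bracket m n B x y \<in> gl_neg m n"
        by (simp only: br k negI)
    next
      fix x y z :: "'a mat" assume "x \<in> gl_neg m n" "y \<in> gl_neg m n" "z \<in> gl_neg m n"
      then obtain c d e where cde: "c \<in> carrier_mat n m" "x = ?ll c" "d \<in> carrier_mat n m"
          "y = ?ll d" "e \<in> carrier_mat n m" "z = ?ll e"
        by (elim negE)
      then show "derived_bracket m n B (x + y) z = derived_bracket m n B x z + derived_bracket m n B y z"
        by (simp only: br add k add_carrier_mat k_add_l)
      from cde show
          "derived_bracket m n B x (y + z) = derived_bracket m n B x y + derived_bracket m n B x z"
        by (simp only: br add k add_carrier_mat k_add_r)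
      from cde show "derived_bracket m n B x (derived_bracket m n B y z) +
          derived_bracket m n B y (derived_bracket m n B z x) +
          derived_bracket m n B z (derived_bracket m n B x y) = 0\<^sub>m (m + n) (m + n)"
        by (simp only: br add k add_carrier_mat k_jacobi zero)
    next
      fix a and x y :: "'a mat" assume "x \<in> gl_neg m n" "y \<in> gl_neg m n"
      then obtain c d where cd: "c \<in> carrier_mat n m" "x = ?ll c" "d \<in> carrier_mat n m" "y = ?ll d"
        by (elim negE)
      then show "derived_bracket m n B (a \<cdot>\<^sub>m x) y = a \<cdot>\<^sub>m derived_bracket m n B x y"
        by (simp only: br smult k smult_carrier_mat k_smult_l[OF cd(1) cd(1) cd(3)])
      from cd show "derived_bracket m n B x (a \<cdot>\<^sub>m y) = a \<cdot>\<^sub>m derived_bracket m n B x y"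
        by (simp only: br smult k smult_carrier_mat k_smult_r[OF cd(3) cd(3) cd(1)])
    next
      fix x :: "'a mat" assume "x \<in> gl_neg m n"
      then obtain c where "c \<in> carrier_mat n m" "x = ?ll c"
        by (elim negE)
      then show "derived_bracket m n B x x = 0\<^sub>m (m + n) (m + n)"
        by (simp only: br k_self zero)
    qed
  qed
  ultimately show ?thesis
    by (simp add: lie_algebra_def)
qed

end

theory Submission
  imports Defs
begin

text \<open>
  Writing $b = P J_r Q$ with $P, Q$ invertible and $J_r$ the $m \times n$ matrix with $r$ leading
  ones on its diagonal, the map $c \mapsto Q c P$ turns the bracket $c b c' - c' b c$ into
  $c J_r c' - c' J_r c$, so only $m$, $n$ and $r$ matter, and $c \mapsto -c^T$ exchanges $m$ and $n$.

  Conversely, $m$, $n$, $r$ are read off from isomorphism invariants. The Killing form is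
  $\kappa(u, v) = (m + n) \operatorname{tr}(xy) - 2 \operatorname{tr} x \operatorname{tr} y$,
  where $x, y$ are the upper left $r \times r$ blocks of $u, v$. Unless $m = n = r$, its radical is
  $x = 0$, of dimension $mn - r^2$, and the center is the lower right block, of dimension
  $(m - r)(n - r)$. In the case $m = n = r$, which is the one where the radical is central, the total
  dimension $mn$ suffices.
\<close>

section \<open>Linear maps on functions of finite support\<close>

text \<open>The three dimensions suffice because mn and mn - r^2 give r, after which (m - r)(n - r)
  = mn - r(m + n) + r^2 gives m + n, as r is nonzero; sum and product fix the unordered pair. The
  exception m = n = r has a concrete source: the trace of a radical element satisfies (m + n - 2r)
  tr x = 0, and r \<le> m, r \<le> n make the factor vanish only there. The algebra is then gl_r,
  where radical and center both consist of the scalars, so neither dimension formula holds. In all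
  other cases a matrix unit with exactly one index below r lies in the radical without being
  central, so centrality of the radical separates the two situations intrinsically. Outside the
  exception radical and center are coordinate subspaces, so their dimensions are cardinalities of
  index sets. The single identity tr(GF) = tr(FG) both transports the Killing form and compares
  dimensions; characteristic zero makes the factors m + n and m + n - 2r cancellable and lets a
  trace determine a cardinality.\<close>

definition supp_fun :: "'i set \<Rightarrow> ('i \<Rightarrow> 'k::field) set" where
  "supp_fun S = {u. \<forall>x. x \<notin> S \<longrightarrow> u x = 0}"

definition unit_fun :: "'i \<Rightarrow> 'i \<Rightarrow> 'k::field" where
  "unit_fun a = (\<lambda>x. if x = a then 1 else 0)"

text \<open>Linearity is required only on \<open>supp_fun S\<close>: a Lie algebra isomorphism and
  its \<open>inv_into\<close> are controlled on the carrier alone.\<close>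

definition linear_on_supp :: "'i set \<Rightarrow> (('i \<Rightarrow> 'k::field) \<Rightarrow> ('j \<Rightarrow> 'k)) \<Rightarrow> bool" where
  "linear_on_supp S F \<longleftrightarrow>
     (\<forall>u\<in>supp_fun S. \<forall>v\<in>supp_fun S. F (\<lambda>x. u x + v x) = (\<lambda>y. F u y + F v y)) \<and>
     (\<forall>c. \<forall>u\<in>supp_fun S. F (\<lambda>x. c * u x) = (\<lambda>y. c * F u y))"

definition op_trace :: "'i set \<Rightarrow> (('i \<Rightarrow> 'k::field) \<Rightarrow> ('i \<Rightarrow> 'k)) \<Rightarrow> 'k" where
  "op_trace S F = (\<Sum>a\<in>S. F (unit_fun a) a)"

lemma supp_funD: "u \<in> supp_fun S \<Longrightarrow> x \<notin> S \<Longrightarrow> u x = 0"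
  by (simp add: supp_fun_def)

lemma supp_fun_mono: "S \<subseteq> T \<Longrightarrow> supp_fun S \<subseteq> supp_fun T"
  by (auto simp: supp_fun_def)

lemma unit_fun_mem: "a \<in> S \<Longrightarrow> unit_fun a \<in> supp_fun S"
  by (auto simp: supp_fun_def unit_fun_def)

lemma linear_on_suppD:
  assumes "linear_on_supp S F" "u \<in> supp_fun S"
  shows "v \<in> supp_fun S \<Longrightarrow> F (\<lambda>x. u x + v x) = (\<lambda>y. F u y + F v y)"
    and "F (\<lambda>x. c * u x) = (\<lambda>y. c * F u y)"
  using assms by (auto simp only: linear_on_supp_def)

lemma linear_on_supp_mono: "linear_on_supp T F \<Longrightarrow> S \<subseteq> T \<Longrightarrow> linear_on_supp S F"
  using supp_fun_mono[of S T] unfolding linear_on_supp_def by blast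

lemma linear_on_supp_expand:
  fixes F :: "('i \<Rightarrow> 'k::field) \<Rightarrow> ('j \<Rightarrow> 'k)"
  assumes lin: "linear_on_supp S F" and "finite S" and "u \<in> supp_fun S"
  shows "F u y = (\<Sum>a\<in>S. u a * F (unit_fun a) y)"
proof -
  \<comment> \<open>The induction truncates \<open>u\<close> to a growing subset of
    \<open>S\<close>, adding one coordinate at a time.\<close>
  have "F (\<lambda>x. if x \<in> S' then u x else 0) y = (\<Sum>a\<in>S'. u a * F (unit_fun a) y)"
    if "finite S'" "S' \<subseteq> S" for S'
    using that
  proof (induction S' rule: finite_induct)
    case empty
    have "(\<lambda>x. 0) \<in> supp_fun S"
      by (simp add: supp_fun_def)
    from linear_on_suppD(2)[OF lin this, of 0] have "F (\<lambda>x. 0) = (\<lambda>y. 0)"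
      by (simp only: mult_zero_left)
    then show ?case
      by simp
  next
    case (insert a S')
    let ?v = "\<lambda>x. if x \<in> S' then u x else 0"
    have a: "unit_fun a \<in> supp_fun S"
      using insert.prems by (intro unit_fun_mem) simp
    have mem: "?v \<in> supp_fun S" "(\<lambda>x. u a * unit_fun a x) \<in> supp_fun S"
      using insert.prems by (auto simp: supp_fun_def unit_fun_def)
    have split: "(\<lambda>x. if x \<in> insert a S' then u x else 0) = (\<lambda>x. u a * unit_fun a x + ?v x)"
      using insert.hyps(2) by (auto simp: unit_fun_def)
    have "F (\<lambda>x. if x \<in> insert a S' then u x else 0) y = u a * F (unit_fun a) y + F ?v y"
      unfolding split linear_on_suppD(1)[OF lin mem(2,1)] linear_on_suppD(2)[OF lin a] ..
    then show ?case
      using insert by simp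
  qed
  moreover have "(\<lambda>x. if x \<in> S then u x else 0) = u"
    using assms(3) by (auto simp: supp_fun_def)
  ultimately show ?thesis
    using assms(2) by (metis subset_refl)
qed

text \<open>Both sides are the same double sum over the entries of the two rectangular matrices of
  \<open>F\<close> and \<open>G\<close>. The domains may differ, which is what allows a trace to be
  compared across an isomorphism.\<close>

lemma op_trace_commute:
  fixes F :: "('i \<Rightarrow> 'k::field) \<Rightarrow> ('j \<Rightarrow> 'k)"
  assumes "finite S" "finite T"
    and F: "linear_on_supp S F" "F ` supp_fun S \<subseteq> supp_fun T"
    and G: "linear_on_supp T G" "G ` supp_fun T \<subseteq> supp_fun S"
  shows "op_trace S (\<lambda>u. G (F u)) = op_trace T (\<lambda>u. F (G u))"
proof -
  have F_mem: "F (unit_fun a) \<in> supp_fun T" if "a \<in> S" for a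
    using F(2) unit_fun_mem[OF that] by blast
  have G_mem: "G (unit_fun b) \<in> supp_fun S" if "b \<in> T" for b
    using G(2) unit_fun_mem[OF that] by blast
  have "op_trace S (\<lambda>u. G (F u)) = (\<Sum>a\<in>S. \<Sum>b\<in>T. F (unit_fun a) b * G (unit_fun b) a)"
    unfolding op_trace_def
    by (rule sum.cong[OF refl]) (rule linear_on_supp_expand[OF G(1) assms(2) F_mem])
  also have "\<dots> = (\<Sum>b\<in>T. \<Sum>a\<in>S. G (unit_fun b) a * F (unit_fun a) b)"
    by (subst sum.swap) (simp add: mult.commute)
  also have "\<dots> = op_trace T (\<lambda>u. F (G u))"
    unfolding op_trace_def
    by (rule sum.cong[OF refl]) (rule linear_on_supp_expand[OF F(1) assms(1) G_mem, symmetric])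
  finally show ?thesis .
qed

text \<open>In characteristic zero the dimension is the trace of the identity.\<close>

lemma supp_fun_iso_card_eq:
  fixes F :: "('i \<Rightarrow> 'k::field_char_0) \<Rightarrow> ('j \<Rightarrow> 'k)"
  assumes "finite S" "finite T"
    and F: "linear_on_supp S F" "F ` supp_fun S \<subseteq> supp_fun T" "\<And>u. u \<in> supp_fun S \<Longrightarrow> G (F u) = u"
    and G: "linear_on_supp T G" "G ` supp_fun T \<subseteq> supp_fun S" "\<And>v. v \<in> supp_fun T \<Longrightarrow> F (G v) = v"
  shows "card S = card T"
proof -
  have "op_trace S (\<lambda>u. G (F u)) = of_nat (card S)"
    unfolding op_trace_def by (simp add: F(3) unit_fun_mem) (simp add: unit_fun_def)
  moreover have "op_trace T (\<lambda>u. F (G u)) = of_nat (card T)"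
    unfolding op_trace_def by (simp add: G(3) unit_fun_mem) (simp add: unit_fun_def)
  ultimately have "(of_nat (card S) :: 'k) = of_nat (card T)"
    using op_trace_commute[OF assms(1,2) F(1,2) G(1,2)] by simp
  then show ?thesis
    by simp
qed

section \<open>Killing form and center of the truncated bracket\<close>

text \<open>\<open>grid m n\<close> indexes the entries of an $n \times m$ matrix $c$; for $b$ the $m \times n$ matrix
  with $r$ leading ones on the diagonal, \<open>trunc_bracket r\<close> is $c b c' - c' b c$.\<close>

definition grid :: "nat \<Rightarrow> nat \<Rightarrow> (nat \<times> nat) set" where
  "grid m n = {..<n} \<times> {..<m}"

definition trunc_bracket :: "nat \<Rightarrow> (nat \<times> nat \<Rightarrow> 'k::field) \<Rightarrow> (nat \<times> nat \<Rightarrow> 'k) \<Rightarrow> nat \<times> nat \<Rightarrow> 'k" where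
  "trunc_bracket r u v = (\<lambda>(i, j). \<Sum>l<r. u (i, l) * v (l, j) - v (i, l) * u (l, j))"

definition killing :: "nat \<Rightarrow> nat \<Rightarrow> nat \<Rightarrow> (nat \<times> nat \<Rightarrow> 'k::field) \<Rightarrow> (nat \<times> nat \<Rightarrow> 'k) \<Rightarrow> 'k" where
  "killing m n r u v = op_trace (grid m n) (\<lambda>w. trunc_bracket r u (trunc_bracket r v w))"

definition killing_radical :: "nat \<Rightarrow> nat \<Rightarrow> nat \<Rightarrow> (nat \<times> nat \<Rightarrow> 'k::field) set" where
  "killing_radical m n r =
     {u \<in> supp_fun (grid m n). \<forall>v\<in>supp_fun (grid m n). killing m n r u v = 0}"

definition trunc_center :: "nat \<Rightarrow> nat \<Rightarrow> nat \<Rightarrow> (nat \<times> nat \<Rightarrow> 'k::field) set" where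
  "trunc_center m n r =
     {u \<in> supp_fun (grid m n). \<forall>v\<in>supp_fun (grid m n). \<forall>x. trunc_bracket r u v x = 0}"

lemma finite_grid [simp]: "finite (grid m n)"
  by (simp add: grid_def)

lemma card_grid: "card (grid m n) = m * n"
  by (simp add: grid_def)

lemma grid_mono: "m \<le> p \<Longrightarrow> n \<le> q \<Longrightarrow> grid m n \<subseteq> grid p q"
  by (auto simp: grid_def)

lemma trunc_bracket_mem:
  assumes "r \<le> m" "r \<le> n" "u \<in> supp_fun (grid m n)" "v \<in> supp_fun (grid m n)"
  shows "trunc_bracket r u v \<in> supp_fun (grid m n)"
proof -
  have "trunc_bracket r u v (i, j) = 0" if "(i, j) \<notin> grid m n" for i j
    unfolding trunc_bracket_def prod.case
  proof (intro sum.neutral ballI)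
    fix l assume "l \<in> {..<r}"
    then have "(i, l) \<notin> grid m n \<or> (l, j) \<notin> grid m n" "(l, j) \<notin> grid m n \<or> (i, l) \<notin> grid m n"
      and "i < n \<Longrightarrow> (l, j) \<notin> grid m n" "\<not> i < n \<Longrightarrow> (i, l) \<notin> grid m n"
      using that assms(1,2) by (auto simp: grid_def)
    then show "u (i, l) * v (l, j) - v (i, l) * u (l, j) = 0"
      using assms(3,4) by (cases "i < n") (auto simp: supp_fun_def)
  qed
  then show ?thesis
    by (auto simp: supp_fun_def)
qed

lemma linear_trunc_bracket: "linear_on_supp S (trunc_bracket r u)"
  by (auto simp: linear_on_supp_def trunc_bracket_def fun_eq_iff sum.distrib[symmetric]
      sum_distrib_left algebra_simps intro!: sum.cong)

text \<open>The adjoint map is left minus right multiplication. On n x m matrices the product of two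
  left multiplications has trace m tr(xy), that of two right multiplications n tr(xy), and each
  mixed term contributes - tr x tr y.\<close>

lemma killing_eq:
  fixes u v :: "nat \<times> nat \<Rightarrow> 'k::field"
  assumes "r \<le> m" "r \<le> n"
  shows "killing m n r u v = of_nat (m + n) * (\<Sum>i<r. \<Sum>l<r. u (i, l) * v (l, i))
    - 2 * (\<Sum>i<r. u (i, i)) * (\<Sum>i<r. v (i, i))"
proof -
  define P where "P i = (\<Sum>l<r. u (i, l) * v (l, i))" for i
  define Q where "Q i = (\<Sum>l<r. v (i, l) * u (l, i))" for i
  let ?on = "\<lambda>i (x::'k). if i < r then x else 0"
  have inner: "trunc_bracket r v (unit_fun (i, j)) (a, b) =
      ?on i (if b = j then v (a, i) else 0) - (if a = i then ?on j (v (j, b)) else 0)" for i j a b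
  proof -
    have "(\<Sum>l<r. v (a, l) * unit_fun (i, j) (l, b)) = (\<Sum>l<r. if l = i then (if b = j then v (a, i) else 0) else 0)"
      by (intro sum.cong) (auto simp: unit_fun_def)
    moreover have "(\<Sum>l<r. unit_fun (i, j) (a, l) * v (l, b)) = (\<Sum>l<r. if l = j then (if a = i then v (j, b) else 0) else 0)"
      by (intro sum.cong) (auto simp: unit_fun_def)
    ultimately show ?thesis
      by (simp add: trunc_bracket_def sum_subtractf sum.delta')
  qed
  \<comment> \<open>Diagonal coefficient at the matrix unit (i, j): \<open>P i\<close> stems from
    left-left, \<open>Q j\<close> from right-right, the two products from the mixed terms.\<close>
  have entry: "trunc_bracket r u (trunc_bracket r v (unit_fun (i, j))) (i, j) =
      ?on i (P i) - ?on i (u (i, i)) * ?on j (v (j, j))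
      - ?on i (v (i, i)) * ?on j (u (j, j)) + ?on j (Q j)" for i j
  proof -
    have "(\<Sum>l<r. u (i, l) * trunc_bracket r v (unit_fun (i, j)) (l, j)) =
        (\<Sum>l<r. ?on i (u (i, l) * v (l, i)) - (if l = i then u (i, i) * ?on j (v (j, j)) else 0))"
      by (intro sum.cong) (auto simp: inner algebra_simps)
    moreover have "(\<Sum>l<r. trunc_bracket r v (unit_fun (i, j)) (i, l) * u (l, j)) =
        (\<Sum>l<r. (if l = j then ?on i (v (i, i)) * u (j, j) else 0) - ?on j (v (j, l) * u (l, j)))"
      by (intro sum.cong) (auto simp: inner algebra_simps)
    ultimately show ?thesis
      by (auto simp: trunc_bracket_def sum_subtractf P_def Q_def)
  qed
  have on: "(\<Sum>i<k. ?on i (f i)) = (\<Sum>i<r. f i)" if "r \<le> k" for k f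
    using that by (intro sum.mono_neutral_cong_right) auto
  have PQ: "(\<Sum>i<r. Q i) = (\<Sum>i<r. P i)"
    unfolding P_def Q_def by (subst sum.swap) (simp add: mult.commute)
  have "killing m n r u v = (\<Sum>i<n. \<Sum>j<m. ?on i (P i) - ?on i (u (i, i)) * ?on j (v (j, j))
      - ?on i (v (i, i)) * ?on j (u (j, j)) + ?on j (Q j))"
    unfolding killing_def op_trace_def grid_def sum.cartesian_product
    by (intro sum.cong refl) (auto simp only: entry split: prod.splits)
  also have "\<dots> = of_nat m * (\<Sum>i<r. P i) - (\<Sum>i<r. u (i, i)) * (\<Sum>i<r. v (i, i))
      - (\<Sum>i<r. v (i, i)) * (\<Sum>i<r. u (i, i)) + of_nat n * (\<Sum>i<r. Q i)"
    by (simp only: sum.distrib sum_subtractf sum_distrib_left[symmetric] sum_distrib_right[symmetric]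
        on[OF assms(1)] on[OF assms(2)] sum_constant card_lessThan)
  also have "\<dots> = of_nat (m + n) * (\<Sum>i<r. P i) - 2 * (\<Sum>i<r. u (i, i)) * (\<Sum>i<r. v (i, i))"
    unfolding PQ by (simp add: algebra_simps)
  finally show ?thesis
    by (simp add: P_def)
qed

text \<open>Pairing with matrix units tests the radical one entry at a time; the trace term of the
  form is seen only by diagonal units.\<close>

lemma killing_radical_entry:
  fixes u :: "nat \<times> nat \<Rightarrow> 'k::field_char_0"
  assumes r: "r \<le> m" "r \<le> n" and u: "u \<in> killing_radical m n r" and ij: "i < r" "j < r"
  shows "of_nat (m + n) * u (i, j) = (if i = j then 2 * (\<Sum>l<r. u (l, l)) else 0)"
proof -
  \<comment> \<open>The indices are transposed because tr(x E_ji) = x_ij.\<close>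
  have "unit_fun (j, i) \<in> supp_fun (grid m n)"
    using r ij by (intro unit_fun_mem) (simp add: grid_def)
  then have "killing m n r u (unit_fun (j, i)) = 0"
    using u by (auto simp: killing_radical_def)
  moreover have "(\<Sum>a<r. \<Sum>l<r. u (a, l) * unit_fun (j, i) (l, a)) = u (i, j)"
  proof -
    have "(\<Sum>a<r. \<Sum>l<r. u (a, l) * unit_fun (j, i) (l, a)) =
        (\<Sum>a<r. \<Sum>l<r. if l = j then (if a = i then u (i, j) else 0) else 0)"
      by (intro sum.cong) (auto simp: unit_fun_def)
    then show ?thesis
      using ij by simp
  qed
  moreover have "(\<Sum>l<r. unit_fun (j, i) (l, l)) = (if i = j then 1 else 0 :: 'k)"
  proof -
    have "(\<Sum>l<r. unit_fun (j, i) (l, l)) = (\<Sum>l<r. if l = j then (if i = j then 1 else 0 :: 'k) else 0)"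
      by (intro sum.cong) (auto simp: unit_fun_def)
    then show ?thesis
      using ij by simp
  qed
  ultimately show ?thesis
    unfolding killing_eq[OF r] by (auto split: if_splits)
qed

text \<open>Summing the diagonal entry identities gives (m + n) tr x = 2 r tr x, so the trace
  vanishes by \<open>ne\<close>; the same identities then kill every entry of the block.\<close>

lemma killing_radical_eq:
  assumes r: "r \<le> m" "r \<le> n" and ne: "m + n \<noteq> 2 * r"
  shows "(killing_radical m n r :: (nat \<times> nat \<Rightarrow> 'k::field_char_0) set) = supp_fun (grid m n - grid r r)"
proof (intro equalityI subsetI)
  fix u :: "nat \<times> nat \<Rightarrow> 'k" assume u: "u \<in> killing_radical m n r"
  note entry = killing_radical_entry[OF r u]
  have "(\<Sum>i<r. of_nat (m + n) * u (i, i)) = (\<Sum>i<r. 2 * (\<Sum>l<r. u (l, l)))"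
    by (intro sum.cong) (auto simp: entry simp del: of_nat_add)
  then have "(of_nat (m + n) - of_nat (2 * r)) * (\<Sum>l<r. u (l, l)) = 0"
    by (simp add: sum_distrib_left[symmetric] algebra_simps)
  moreover have "(of_nat (m + n) - of_nat (2 * r) :: 'k) \<noteq> 0"
    using ne by (metis eq_iff_diff_eq_0 of_nat_eq_iff)
  ultimately have "(\<Sum>l<r. u (l, l)) = 0"
    by (metis mult_eq_0_iff)
  moreover have "(of_nat (m + n) :: 'k) \<noteq> 0"
    using ne r by (metis add_is_0 le_zero_eq mult_0_right of_nat_eq_0_iff)
  ultimately have "u (i, j) = 0" if "i < r" "j < r" for i j
    using entry[OF that] by (auto split: if_splits simp del: of_nat_add)
  moreover have "u \<in> supp_fun (grid m n)"
    using u by (simp add: killing_radical_def)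
  ultimately show "u \<in> supp_fun (grid m n - grid r r)"
    by (auto simp: supp_fun_def grid_def)
next
  fix u :: "nat \<times> nat \<Rightarrow> 'k" assume u: "u \<in> supp_fun (grid m n - grid r r)"
  then have "u (i, j) = 0" if "i < r" "j < r" for i j
    using that by (intro supp_funD[OF u]) (simp add: grid_def)
  then have "killing m n r u v = 0" for v
    unfolding killing_eq[OF r] by simp
  then show "u \<in> killing_radical m n r"
    using u supp_fun_mono[of "grid m n - grid r r" "grid m n"] by (auto simp: killing_radical_def)
qed

text \<open>With m = n = r the bracket is the commutator of gl_r, and the entry identities say that
  a radical element is a scalar matrix.\<close>

lemma killing_radical_full_rank_subset_center:
  assumes "r \<ge> 1"
  shows "(killing_radical r r r :: (nat \<times> nat \<Rightarrow> 'k::field_char_0) set) \<subseteq> trunc_center r r r"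
proof
  fix u :: "nat \<times> nat \<Rightarrow> 'k" assume u: "u \<in> killing_radical r r r"
  \<comment> \<open>The diagonal entry identity solved for \<open>u (i, i)\<close>.\<close>
  define c where "c = 2 * (\<Sum>l<r. u (l, l)) / of_nat (r + r)"
  have r0: "(of_nat (r + r) :: 'k) \<noteq> 0"
    using assms by (metis add_is_0 not_one_le_zero of_nat_eq_0_iff)
  have scalar: "u (i, j) = (if i = j then c else 0)" if "i < r" "j < r" for i j
    using killing_radical_entry[OF order_refl order_refl u that] r0
    by (auto simp: c_def eq_divide_eq mult.commute simp del: of_nat_add split: if_splits)
  have "trunc_bracket r u v (i, j) = 0" if v: "v \<in> supp_fun (grid r r)" for v i j
  proof (cases "i < r \<and> j < r")
    case True
    then have "(\<Sum>l<r. u (i, l) * v (l, j)) = (\<Sum>l<r. if l = i then c * v (i, j) else 0)"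
      and "(\<Sum>l<r. v (i, l) * u (l, j)) = (\<Sum>l<r. if l = j then c * v (i, j) else 0)"
      by (intro sum.cong; use True in \<open>simp add: scalar\<close>)+
    then show ?thesis
      using True by (simp add: trunc_bracket_def sum_subtractf)
  next
    case False
    then have "(i, j) \<notin> grid r r"
      by (auto simp: grid_def)
    moreover have "trunc_bracket r u v \<in> supp_fun (grid r r)"
      using u v by (intro trunc_bracket_mem) (auto simp: killing_radical_def)
    ultimately show ?thesis
      by (simp add: supp_funD)
  qed
  then show "u \<in> trunc_center r r r"
    using u by (auto simp: killing_radical_def trunc_center_def)
qed

lemma trunc_bracket_unit_right:
  "trunc_bracket r u (unit_fun (a, b)) (i, j) =
     (if a < r \<and> j = b then u (i, a) else 0) - (if i = a \<and> b < r then u (b, j) else 0)"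
proof -
  have "(\<Sum>l<r. u (i, l) * unit_fun (a, b) (l, j)) = (\<Sum>l<r. if l = a then (if j = b then u (i, a) else 0) else 0)"
    and "(\<Sum>l<r. unit_fun (a, b) (i, l) * u (l, j)) = (\<Sum>l<r. if l = b then (if i = a then u (b, j) else 0) else 0)"
    by (intro sum.cong; auto simp: unit_fun_def)+
  then show ?thesis
    by (simp add: trunc_bracket_def sum_subtractf)
qed

text \<open>By \<open>ne\<close>, one of the two sizes exceeds r. A matrix unit with one index equal
  to r and the other below r then has only one nonzero term in its bracket with \<open>u\<close>, so
  that term must vanish.\<close>

lemma trunc_center_eq:
  assumes r: "r \<le> m" "r \<le> n" "r \<ge> 1" and ne: "m + n \<noteq> 2 * r"
  shows "(trunc_center m n r :: (nat \<times> nat \<Rightarrow> 'k::field) set) = supp_fun ({r..<n} \<times> {r..<m})"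
proof (intro equalityI subsetI)
  fix u :: "nat \<times> nat \<Rightarrow> 'k" assume u: "u \<in> trunc_center m n r"
  have br: "trunc_bracket r u (unit_fun (a, b)) x = 0" if "a < n" "b < m" for a b x
  proof -
    have "unit_fun (a, b) \<in> supp_fun (grid m n)"
      using that by (intro unit_fun_mem) (simp add: grid_def)
    then show ?thesis
      using u unfolding trunc_center_def by blast
  qed
  have "u (i, j) = 0" if "i < n" "j < m" "i < r \<or> j < r" for i j
  proof -
    consider (col) "r < m" | (row) "r < n"
      using ne r by linarith
    then show ?thesis
    proof cases
      case col
      \<comment> \<open>The unit (k, r) has column index outside the truncation, so the subtracted
        term drops out and column k of \<open>u\<close> remains.\<close>
      have left: "u (i, k) = 0" if "k < r" for i k
        using br[of k r "(i, r)"] that col r by (auto simp: trunc_bracket_unit_right split: if_splits)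
      \<comment> \<open>The diagonal unit (i, i) recovers row i of \<open>u\<close> outside the
        leading columns, where the first term is absent.\<close>
      have "u (i, j) = 0" if "i < r" "\<not> j < r" "j < m"
        using br[of i i "(i, j)"] that r by (auto simp: trunc_bracket_unit_right)
      then show ?thesis
        using left that by auto
    next
      case row
      \<comment> \<open>Mirror image: the unit (r, k) leaves only row k of \<open>u\<close>.\<close>
      have top: "u (k, j) = 0" if "k < r" for j k
        using br[of r k "(r, j)"] that row r by (auto simp: trunc_bracket_unit_right split: if_splits)
      have "u (i, j) = 0" if "\<not> i < r" "j < r" "i < n"
        using br[of j j "(i, j)"] that r by (auto simp: trunc_bracket_unit_right)
      then show ?thesis
        using top that by auto
    qed
  qed
  moreover have "u (i, j) = 0" if "\<not> (i < n \<and> j < m)" for i j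
  proof (rule supp_funD[of u "grid m n"])
    show "u \<in> supp_fun (grid m n)"
      using u by (simp add: trunc_center_def)
    show "(i, j) \<notin> grid m n"
      using that by (simp add: grid_def)
  qed
  ultimately have "u (i, j) = 0" if "(i, j) \<notin> {r..<n} \<times> {r..<m}" for i j
    using that by (cases "i < n \<and> j < m") auto
  then show "u \<in> supp_fun ({r..<n} \<times> {r..<m})"
    by (simp add: supp_fun_def)
next
  fix u :: "nat \<times> nat \<Rightarrow> 'k" assume u: "u \<in> supp_fun ({r..<n} \<times> {r..<m})"
  then have "trunc_bracket r u v x = 0" for v x
    by (auto simp: trunc_bracket_def supp_fun_def split: prod.splits intro!: sum.neutral)
  moreover have "{r..<n} \<times> {r..<m} \<subseteq> grid m n"
    by (auto simp: grid_def)
  ultimately show "u \<in> trunc_center m n r"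
    using u supp_fun_mono unfolding trunc_center_def by blast
qed

lemma killing_radical_not_subset_center:
  assumes r: "r \<le> m" "r \<le> n" "r \<ge> 1" and ne: "m + n \<noteq> 2 * r"
  shows "\<not> (killing_radical m n r :: (nat \<times> nat \<Rightarrow> 'k::field_char_0) set) \<subseteq> trunc_center m n r"
proof -
  \<comment> \<open>One index at least r puts the unit outside the r x r block, hence into the
    radical; the other index 0 < r keeps it out of the center.\<close>
  obtain x where x: "x \<in> grid m n - grid r r" "x \<notin> {r..<n} \<times> {r..<m}"
  proof (cases "r < m")
    case True
    then show ?thesis
      using r by (intro that[of "(0, r)"]) (auto simp: grid_def)
  next
    case False
    then show ?thesis
      using r ne by (intro that[of "(r, 0)"]) (auto simp: grid_def)
  qed
  have "(unit_fun x :: nat \<times> nat \<Rightarrow> 'k) \<in> killing_radical m n r"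
    unfolding killing_radical_eq[OF r(1,2) ne] using x(1) by (rule unit_fun_mem)
  moreover have "(unit_fun x :: nat \<times> nat \<Rightarrow> 'k) \<notin> trunc_center m n r"
    unfolding trunc_center_eq[OF r ne] using x(2) by (cases x) (simp add: supp_fun_def unit_fun_def)
  ultimately show ?thesis
    by blast
qed

section \<open>Transport of the invariants along an isomorphism\<close>

locale trunc_iso =
  fixes m n r p q s :: nat and F G :: "(nat \<times> nat \<Rightarrow> 'k::field_char_0) \<Rightarrow> (nat \<times> nat \<Rightarrow> 'k)"
  assumes ranks: "r \<le> m" "r \<le> n" "1 \<le> r" "s \<le> p" "s \<le> q" "1 \<le> s"
    and F_lin: "linear_on_supp (grid m n) F"
    and F_img: "F ` supp_fun (grid m n) \<subseteq> supp_fun (grid p q)"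
    and GF: "\<And>u. u \<in> supp_fun (grid m n) \<Longrightarrow> G (F u) = u"
    and G_lin: "linear_on_supp (grid p q) G"
    and G_img: "G ` supp_fun (grid p q) \<subseteq> supp_fun (grid m n)"
    and FG: "\<And>v. v \<in> supp_fun (grid p q) \<Longrightarrow> F (G v) = v"
    and F_bracket: "\<And>u v. u \<in> supp_fun (grid m n) \<Longrightarrow> v \<in> supp_fun (grid m n) \<Longrightarrow>
      F (trunc_bracket r u v) = trunc_bracket s (F u) (F v)"
begin

lemma G_bracket:
  assumes "u \<in> supp_fun (grid p q)" "v \<in> supp_fun (grid p q)"
  shows "G (trunc_bracket s u v) = trunc_bracket r (G u) (G v)"
proof -
  have mem: "G u \<in> supp_fun (grid m n)" "G v \<in> supp_fun (grid m n)"
    using G_img assms by blast+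
  then have "trunc_bracket s u v = F (trunc_bracket r (G u) (G v))"
    by (simp add: F_bracket FG assms)
  then show ?thesis
    using GF[OF trunc_bracket_mem[OF ranks(1,2) mem]] by simp
qed

text \<open>Carrying \<open>F\<close> and \<open>G\<close> on an equal footing makes every inclusion
  proved for \<open>F\<close> available for \<open>G\<close>, so inclusions become
  equalities.\<close>

lemma sym: "trunc_iso p q s m n r G F"
  by unfold_locales (use ranks F_lin F_img GF G_lin G_img FG G_bracket in auto)

text \<open>\<open>F\<close> conjugates the operator w \<mapsto> [u, [v, w]] into the corresponding
  one for \<open>F u\<close> and \<open>F v\<close>, and conjugation preserves the trace:
  \<open>op_trace_commute\<close> is applied to \<open>F\<close> and the composite of that operator
  with \<open>G\<close>.\<close>

lemma killing_F:
  assumes u: "u \<in> supp_fun (grid m n)" and v: "v \<in> supp_fun (grid m n)"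
  shows "killing p q s (F u) (F v) = killing m n r u v"
proof -
  let ?M = "\<lambda>w. trunc_bracket r u (trunc_bracket r v w)"
  have M: "?M w \<in> supp_fun (grid m n)" if "w \<in> supp_fun (grid m n)" for w
    using that u v ranks by (intro trunc_bracket_mem)
  have M_lin: "linear_on_supp (grid m n) ?M"
    using linear_trunc_bracket[of "grid m n" r u] linear_trunc_bracket[of "grid m n" r v]
      trunc_bracket_mem[OF ranks(1,2) v]
    by (simp add: linear_on_supp_def)
  have G: "G w \<in> supp_fun (grid m n)" if "w \<in> supp_fun (grid p q)" for w
    using G_img that by blast
  have "F (?M (G w)) = trunc_bracket s (F u) (trunc_bracket s (F v) w)"
    if "w \<in> supp_fun (grid p q)" for w
    using G[OF that] u v trunc_bracket_mem[OF ranks(1,2) v G[OF that]] that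
    by (simp add: F_bracket FG)
  then have "killing p q s (F u) (F v) = op_trace (grid p q) (\<lambda>w. F (?M (G w)))"
    by (simp add: killing_def op_trace_def unit_fun_mem)
  also have "\<dots> = op_trace (grid m n) (\<lambda>w. ?M (G (F w)))"
    by (rule op_trace_commute[symmetric, OF _ _ F_lin F_img])
      (use G_lin M_lin G M in \<open>auto simp: linear_on_supp_def\<close>)
  also have "\<dots> = killing m n r u v"
    by (simp add: killing_def op_trace_def unit_fun_mem GF)
  finally show ?thesis .
qed

lemma F_radical: "F ` killing_radical m n r \<subseteq> killing_radical p q s"
proof (intro image_subsetI)
  fix u :: "nat \<times> nat \<Rightarrow> 'k" assume u: "u \<in> killing_radical m n r"
  then have u': "u \<in> supp_fun (grid m n)"
    by (simp add: killing_radical_def)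
  have "killing p q s (F u) v = 0" if "v \<in> supp_fun (grid p q)" for v
    using killing_F[OF u', of "G v"] FG[OF that] G_img that u by (auto simp: killing_radical_def)
  then show "F u \<in> killing_radical p q s"
    using F_img u' by (auto simp: killing_radical_def)
qed

lemma F_center: "F ` trunc_center m n r \<subseteq> trunc_center p q s"
proof (intro image_subsetI)
  fix u :: "nat \<times> nat \<Rightarrow> 'k" assume u: "u \<in> trunc_center m n r"
  then have u': "u \<in> supp_fun (grid m n)"
    by (simp add: trunc_center_def)
  have zero: "F (\<lambda>x. 0) = (\<lambda>x. 0)"
    by (rule ext) (use linear_on_supp_expand[OF F_lin finite_grid] in \<open>simp add: supp_fun_def\<close>)
  have "trunc_bracket s (F u) v = (\<lambda>x. 0)" if "v \<in> supp_fun (grid p q)" for v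
  proof -
    have "G v \<in> supp_fun (grid m n)"
      using G_img that by blast
    moreover from this have "trunc_bracket r u (G v) = (\<lambda>x. 0)"
      using u by (auto simp: trunc_center_def)
    ultimately show ?thesis
      using F_bracket[OF u', of "G v"] by (simp add: FG that zero)
  qed
  then show "F u \<in> trunc_center p q s"
    using F_img u' by (auto simp: trunc_center_def)
qed

text \<open>Together with \<open>sym\<close> this forces both algebras to be of the exceptional
  square full rank type, or neither.\<close>

lemma radical_central_transfer:
  assumes "killing_radical m n r \<subseteq> (trunc_center m n r :: (nat \<times> nat \<Rightarrow> 'k) set)"
  shows "killing_radical p q s \<subseteq> (trunc_center p q s :: (nat \<times> nat \<Rightarrow> 'k) set)"
proof
  fix v :: "nat \<times> nat \<Rightarrow> 'k" assume v: "v \<in> killing_radical p q s"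
  then have "F (G v) \<in> trunc_center p q s"
    using trunc_iso.F_radical[OF sym] assms F_center by blast
  then show "v \<in> trunc_center p q s"
    using v FG by (simp add: killing_radical_def)
qed

text \<open>Extracts one numerical invariant from each pair of corresponding coordinate subspaces:
  the whole space, the radical, the center.\<close>

lemma card_eq:
  assumes "S \<subseteq> grid m n" "T \<subseteq> grid p q"
    and "F ` supp_fun S \<subseteq> supp_fun T" "G ` supp_fun T \<subseteq> supp_fun S"
  shows "card S = card T"
proof (rule supp_fun_iso_card_eq[where F = F and G = G])
  show "finite S" "finite T"
    by (rule finite_subset[OF assms(1) finite_grid], rule finite_subset[OF assms(2) finite_grid])
  show "linear_on_supp S F" "linear_on_supp T G"
    by (rule linear_on_supp_mono[OF F_lin assms(1)], rule linear_on_supp_mono[OF G_lin assms(2)])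
  show "G (F u) = u" if "u \<in> supp_fun S" for u
    by (rule GF[OF subsetD[OF supp_fun_mono[OF assms(1)] that]])
  show "F (G u) = u" if "u \<in> supp_fun T" for u
    by (rule FG[OF subsetD[OF supp_fun_mono[OF assms(2)] that]])
qed (fact assms(3,4))+

text \<open>After r = s is known, write the sizes as r + a, r + b and r + c, r + d. The centers give
  ab = cd, the total dimensions then give a + b = c + d, so {a, b} and {c, d} are the roots of the
  same quadratic.\<close>

lemma parameters_eq: "r = s \<and> {m, n} = {p, q}"
proof -
  have dim: "m * n = p * q"
    using card_eq[OF order_refl order_refl F_img G_img] by (simp add: card_grid)
  have full: "m + n = 2 * r \<longleftrightarrow> m = r \<and> n = r" "p + q = 2 * s \<longleftrightarrow> p = s \<and> q = s"
    using ranks by auto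
  have "m + n = 2 * r \<longleftrightarrow> p + q = 2 * s"
    using killing_radical_full_rank_subset_center[OF ranks(3), where 'k = 'k]
      killing_radical_full_rank_subset_center[OF ranks(6), where 'k = 'k]
      killing_radical_not_subset_center[OF ranks(1-3), where 'k = 'k]
      killing_radical_not_subset_center[OF ranks(4-6), where 'k = 'k]
      radical_central_transfer trunc_iso.radical_central_transfer[OF sym] full
    by metis
  then consider (degenerate) "m = r" "n = r" "p = s" "q = s"
    | (nondegenerate) "m + n \<noteq> 2 * r" "p + q \<noteq> 2 * s"
    using full by blast
  then show ?thesis
  proof cases
    case degenerate
    then have "r = s"
      using dim by (metis power2_eq_square power2_eq_iff_nonneg zero_le)
    then show ?thesis
      using degenerate by simp
  next
    case nondegenerate
    note radical = killing_radical_eq[OF ranks(1,2) nondegenerate(1), where 'k = 'k]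
      killing_radical_eq[OF ranks(4,5) nondegenerate(2), where 'k = 'k]
    note center = trunc_center_eq[OF ranks(1-3) nondegenerate(1), where 'k = 'k]
      trunc_center_eq[OF ranks(4-6) nondegenerate(2), where 'k = 'k]
    have "card (grid m n - grid r r) = card (grid p q - grid s s)"
      using F_radical trunc_iso.F_radical[OF sym] by (intro card_eq) (auto simp: radical)
    moreover have "card (grid m n - grid r r) = m * n - r * r"
      "card (grid p q - grid s s) = p * q - s * s"
      using ranks by (simp_all add: card_Diff_subset grid_mono card_grid)
    \<comment> \<open>Guards the truncated subtraction in the two cardinalities.\<close>
    moreover have "r * r \<le> m * n" "s * s \<le> p * q"
      using ranks by (simp_all add: mult_le_mono)
    ultimately have "r * r = s * s"
      using dim by linarith
    then have rs: "r = s"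
      by (metis power2_eq_square power2_eq_iff_nonneg zero_le)
    have "card ({r..<n} \<times> {r..<m}) = card ({s..<q} \<times> {s..<p})"
      using F_center trunc_iso.F_center[OF sym] by (intro card_eq) (auto simp: center grid_def)
    then have "(n - r) * (m - r) = (q - r) * (p - r)"
      by (simp add: rs)
    moreover obtain a b c d where "m = r + a" "n = r + b" "p = r + c" "q = r + d"
      using ranks rs by (metis le_iff_add)
    ultimately have ab: "b * a = d * c" and sum: "r * (a + b) = r * (c + d)"
      and mn: "m = r + a" "n = r + b" "p = r + c" "q = r + d"
      using dim by (simp_all add: algebra_simps)
    have "a + b = c + d"
      using sum ranks by simp
    \<comment> \<open>The quadratic with roots c and d, evaluated at its root a; integers give
      genuine differences.\<close>
    moreover have "(int a - int c) * (int a - int d) = int a * int a - int a * (int c + int d) + int d * int c"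
      by (simp add: algebra_simps)
    ultimately have "(int a - int c) * (int a - int d) = int a * int a - int a * (int a + int b) + int b * int a"
      by (metis ab of_nat_add of_nat_mult)
    then have "(int a - int c) * (int a - int d) = 0"
      by (simp add: algebra_simps)
    then have "a = c \<or> a = d"
      by auto
    then show ?thesis
      using \<open>a + b = c + d\<close> rs mn by auto
  qed
qed

end

section \<open>Rank normal form\<close>

text \<open>A product through inner dimension k is a sum of k outer products, column of
  \<open>X\<close> times row of \<open>Y\<close>, each of rank at most one. \<open>M l\<close> is
  the partial sum of the first l of them.\<close>

lemma rank_mult_le_inner:
  fixes X Y :: "'a::field mat"
  assumes X: "X \<in> carrier_mat n k" and Y: "Y \<in> carrier_mat k nc"
  shows "vec_space.rank n (X * Y) \<le> k"
proof -
  interpret vec_space "TYPE('a)" n .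
  define M where "M l = mat n nc (\<lambda>(i, j). \<Sum>t<l. X $$ (i, t) * Y $$ (t, j))" for l
  have "rank (M l) \<le> l" for l
  proof (induction l)
    case 0
    have "M 0 = 0\<^sub>m n nc"
      by (auto simp: M_def)
    then show ?case
      by (simp add: rank_0I)
  next
    case (Suc l)
    let ?N = "mat n nc (\<lambda>(i, j). X $$ (i, l) * Y $$ (l, j))"
    have "M (Suc l) = M l + ?N"
      by (auto simp: M_def)
    then have "rank (M (Suc l)) \<le> rank (M l) + rank ?N"
      using rank_subadditive[of "M l" nc ?N] by (simp add: M_def)
    moreover have "rank ?N \<le> 1"
      by (rule rank_le_1_product_entries[of _ nc "\<lambda>i. X $$ (i, l)" "\<lambda>j. Y $$ (l, j)"]) auto
    ultimately show ?case
      using Suc by linarith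
  qed
  moreover have "X * Y = M k"
    using X Y by (auto simp: M_def scalar_prod_def atLeast0LessThan intro!: sum.cong)
  ultimately show ?thesis
    by simp
qed

text \<open>\<open>X\<close> collects a maximal independent set of columns of \<open>A\<close>,
  \<open>Y\<close> their coefficients in each column. With \<open>rank_mult_le_inner\<close> this
  characterizes the rank as the least inner dimension of a factorization, the only form in which
  rank is compared below.\<close>

lemma rank_factorization:
  fixes A :: "'a::field mat"
  assumes A: "A \<in> carrier_mat n nc"
  obtains X Y where "X \<in> carrier_mat n (vec_space.rank n A)" "Y \<in> carrier_mat (vec_space.rank n A) nc"
    "A = X * Y"
proof -
  interpret vec_space "TYPE('a)" n .
  let ?r = "rank A" and ?indpt = "\<lambda>T. T \<subseteq> set (cols A) \<and> lin_indpt T"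
  have cols: "set (cols A) \<subseteq> carrier_vec n"
    using cols_dim A by blast
  have "?indpt {}"
    by (simp add: lin_dep_def)
  then obtain S where S: "maximal S ?indpt"
    using maximal_exists_superset[of "set (cols A)" ?indpt "{}"] by auto
  then have S': "S \<subseteq> set (cols A)" "lin_indpt S"
    by (auto simp: maximal_def)
  then have fin: "finite S"
    using finite_subset by blast
  then obtain xs where xs: "set xs = S" "distinct xs"
    using finite_distinct_list by blast
  have len: "length xs = ?r"
    using rank_card_indpt[OF A S] xs distinct_card by fastforce
  let ?X = "mat_of_cols n xs"
  have X: "?X \<in> carrier_mat n ?r"
    using len by (metis mat_of_cols_carrier(1))
  have cols_X: "cols ?X = xs"
    using xs S' cols by (intro cols_mat_of_cols) auto
  have "\<exists>y. y \<in> carrier_vec ?r \<and> ?X *\<^sub>v y = v" if v: "v \<in> set (cols A)" for v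
  proof -
    have "v \<in> span S"
    proof (rule ccontr)
      assume notin: "v \<notin> span S"
      then have "v \<notin> S"
        using span_mem S' cols by blast
      moreover have "lin_indpt (S \<union> {v})"
        using lin_dep_iff_in_span[of S v] notin S' cols v \<open>v \<notin> S\<close> by auto
      ultimately show False
        using S v S' unfolding maximal_def by blast
    qed
    then obtain a where "v = lincomb a S"
      using finite_in_span[OF fin] S' cols by blast
    then have "?X *\<^sub>v vec ?r (\<lambda>i. a (col ?X i)) = v"
      using mat_mult_eq_lincomb[OF X, of a] cols_X xs by simp
    then show ?thesis
      by (intro exI[of _ "vec ?r (\<lambda>i. a (col ?X i))"]) simp
  qed
  then obtain y where y: "\<And>v. v \<in> set (cols A) \<Longrightarrow> y v \<in> carrier_vec ?r \<and> ?X *\<^sub>v y v = v"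
    by metis
  let ?Y = "mat_of_cols ?r (map y (cols A))"
  have "?Y \<in> carrier_mat ?r nc"
    using A by (metis carrier_matD(2) cols_length length_map mat_of_cols_carrier(1))
  moreover have "A = ?X * ?Y"
  proof (rule mat_col_eqI)
    fix j assume "j < dim_col (?X * ?Y)"
    then have j: "j < nc"
      using A by simp
    then have v: "col A j \<in> set (cols A)"
      using A by (metis carrier_matD(2) cols_length cols_nth nth_mem)
    have "col ?Y j = y (col A j)"
      using j A y[OF v] by (subst col_mat_of_cols) auto
    then show "col A j = col (?X * ?Y) j"
      using y[OF v] j A by (subst col_mult2[OF X, of _ nc]) auto
  qed (use A len in auto)
  ultimately show ?thesis
    using X that by blast
qed

section \<open>Matrix equivalence and elimination\<close>

definition diag_ones :: "nat \<Rightarrow> nat \<Rightarrow> nat \<Rightarrow> 'a::field mat" where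
  "diag_ones m n r = mat m n (\<lambda>(i, j). if i = j \<and> i < r then 1 else 0)"

lemma diag_ones_carrier [simp]: "diag_ones m n r \<in> carrier_mat m n"
  by (simp add: diag_ones_def)

lemma diag_ones_mult:
  assumes "r \<le> k"
  shows "diag_ones m k r * diag_ones k n s = diag_ones m n (min r s)"
proof (rule eq_matI)
  fix i j assume "i < dim_row (diag_ones m n (min r s))" "j < dim_col (diag_ones m n (min r s))"
  then have ij: "i < m" "j < n"
    by (auto simp: diag_ones_def)
  have "(diag_ones m k r * diag_ones k n s) $$ (i, j) =
      (\<Sum>l = 0..<k. (if i = l \<and> i < r then 1 else 0) * (if l = j \<and> l < s then 1 else 0))"
    using ij by (simp add: diag_ones_def scalar_prod_def)
  also have "\<dots> = (\<Sum>l = 0..<k. if l = i then (if i = j \<and> i < min r s then 1 else 0) else 0)"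
    by (rule sum.cong) auto
  finally show "(diag_ones m k r * diag_ones k n s) $$ (i, j) = diag_ones m n (min r s) $$ (i, j)"
    using ij assms by (auto simp: diag_ones_def)
qed (auto simp: diag_ones_def)

lemma diag_ones_self: "diag_ones k k k = 1\<^sub>m k"
  by (auto simp: diag_ones_def)

text \<open>Invertibility is stated through determinants because these are immediate for products
  and block triangular matrices; inverses are recovered by
  \<open>det_nonzero_inverse\<close>.\<close>

definition equivalent_mat :: "nat \<Rightarrow> nat \<Rightarrow> 'a::field mat \<Rightarrow> 'a mat \<Rightarrow> bool" where
  "equivalent_mat m n A C \<longleftrightarrow> (\<exists>P\<in>carrier_mat m m. \<exists>Q\<in>carrier_mat n n.
     det P \<noteq> 0 \<and> det Q \<noteq> 0 \<and> A = P * C * Q)"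

lemma equivalent_matI:
  "\<lbrakk>P \<in> carrier_mat m m; Q \<in> carrier_mat n n; det P \<noteq> 0; det Q \<noteq> 0; A = P * C * Q\<rbrakk>
    \<Longrightarrow> equivalent_mat m n A C"
  unfolding equivalent_mat_def by blast

lemma equivalent_mat_refl: "A \<in> carrier_mat m n \<Longrightarrow> equivalent_mat m n A A"
  by (rule equivalent_matI[of "1\<^sub>m m" _ "1\<^sub>m n"]) auto

lemma equivalent_mat_trans:
  assumes "equivalent_mat m n A C" "equivalent_mat m n C D" and D: "D \<in> carrier_mat m n"
  shows "equivalent_mat m n A D"
proof -
  obtain P Q where PQ: "P \<in> carrier_mat m m" "Q \<in> carrier_mat n n" "det P \<noteq> 0" "det Q \<noteq> 0"
    and A: "A = P * C * Q"
    using assms(1) unfolding equivalent_mat_def by blast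
  obtain R S where RS: "R \<in> carrier_mat m m" "S \<in> carrier_mat n n" "det R \<noteq> 0" "det S \<noteq> 0"
    and C: "C = R * D * S"
    using assms(2) unfolding equivalent_mat_def by blast
  have "P * (R * D * S) * Q = (P * R) * D * (S * Q)"
    using PQ RS D by (simp add: assoc_mult_mat[of _ m m _ m _ n] assoc_mult_mat[of _ m m _ n _ n]
        assoc_mult_mat[of _ m n _ n _ n])
  then show ?thesis
    using PQ RS by (intro equivalent_matI[of "P * R" _ "S * Q"]) (auto simp: A C det_mult)
qed

lemma four_block_diag_ones:
  "four_block_mat (1\<^sub>m 1) (0\<^sub>m 1 n) (0\<^sub>m m 1) (diag_ones m n r) = diag_ones (1 + m) (1 + n) (1 + r)"
  by (rule eq_matI) (auto simp: diag_ones_def)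

lemma equivalent_mat_block:
  assumes "equivalent_mat m n A C" and C: "C \<in> carrier_mat m n"
  shows "equivalent_mat (1 + m) (1 + n) (four_block_mat (1\<^sub>m 1) (0\<^sub>m 1 n) (0\<^sub>m m 1) A)
    (four_block_mat (1\<^sub>m 1) (0\<^sub>m 1 n) (0\<^sub>m m 1) C)"
proof -
  obtain P Q where PQ: "P \<in> carrier_mat m m" "Q \<in> carrier_mat n n" "det P \<noteq> 0" "det Q \<noteq> 0"
    and A: "A = P * C * Q"
    using assms(1) unfolding equivalent_mat_def by blast
  let ?P = "four_block_mat (1\<^sub>m 1) (0\<^sub>m 1 m) (0\<^sub>m m 1) P"
  let ?Q = "four_block_mat (1\<^sub>m 1) (0\<^sub>m 1 n) (0\<^sub>m n 1) Q"
  let ?C = "four_block_mat (1\<^sub>m 1) (0\<^sub>m 1 n) (0\<^sub>m m 1) C"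
  have "?P * ?C = four_block_mat (1\<^sub>m 1) (0\<^sub>m 1 n) (0\<^sub>m m 1) (P * C)"
    using PQ C by (subst mult_four_block_mat[of _ 1 1 _ m _ m _ _ 1 _ n]) auto
  moreover have "\<dots> * ?Q = four_block_mat (1\<^sub>m 1) (0\<^sub>m 1 n) (0\<^sub>m m 1) A"
    using PQ C by (subst mult_four_block_mat[of _ 1 1 _ n _ m _ _ 1 _ n]) (auto simp: A)
  moreover have "det ?P = det P" "det ?Q = det Q"
    using PQ by (simp_all add: det_four_block_mat_upper_right_zero[of _ 1 _ m] 
        det_four_block_mat_upper_right_zero[of _ 1 _ n])
  ultimately show ?thesis
    using PQ by (intro equivalent_matI[of ?P _ ?Q]) auto
qed

text \<open>Block LU decomposition with \<open>D\<close> the Schur complement of the pivot. The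
  pivot stays in the lower factor, which has determinant a, while the upper factor is
  unipotent.\<close>

lemma equivalent_mat_schur:
  fixes C :: "'a::field mat"
  assumes C: "C \<in> carrier_mat (1 + m) (1 + n)" and pivot: "C $$ (0, 0) \<noteq> 0"
  obtains D where "D \<in> carrier_mat m n"
    "equivalent_mat (1 + m) (1 + n) C (four_block_mat (1\<^sub>m 1) (0\<^sub>m 1 n) (0\<^sub>m m 1) D)"
proof -
  obtain C1 C2 C3 C4 where "split_block C 1 1 = (C1, C2, C3, C4)"
    by (cases "split_block C 1 1")
  note block = split_block[OF this, of m n]
  have blocks: "C1 \<in> carrier_mat 1 1" "C2 \<in> carrier_mat 1 n" "C3 \<in> carrier_mat m 1" "C4 \<in> carrier_mat m n"
    and C_eq: "C = four_block_mat C1 C2 C3 C4"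
    using block C by auto
  define a where "a = C $$ (0, 0)"
  have a: "a \<noteq> 0"
    using pivot by (simp add: a_def)
  have C1: "C1 = a \<cdot>\<^sub>m 1\<^sub>m 1"
    using blocks by (intro eq_matI) (auto simp: a_def C_eq)
  let ?U2 = "inverse a \<cdot>\<^sub>m C2"
  let ?D = "C4 - C3 * ?U2"
  let ?L = "four_block_mat C1 (0\<^sub>m 1 m) C3 (1\<^sub>m m)"
  let ?U = "four_block_mat (1\<^sub>m 1) ?U2 (0\<^sub>m n 1) (1\<^sub>m n)"
  let ?M = "four_block_mat (1\<^sub>m 1) (0\<^sub>m 1 n) (0\<^sub>m m 1) ?D"
  have D: "?D \<in> carrier_mat m n" and U2: "?U2 \<in> carrier_mat 1 n"
    using blocks by auto
  have LM: "?L * ?M = four_block_mat C1 (0\<^sub>m 1 n) C3 ?D"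
    using blocks D by (subst mult_four_block_mat[of _ 1 1 _ m _ m _ _ 1 _ n]) auto
  have LMU: "four_block_mat C1 (0\<^sub>m 1 n) C3 ?D * ?U = four_block_mat C1 (C1 * ?U2) C3 (C3 * ?U2 + ?D)"
    using blocks D U2 by (subst mult_four_block_mat[of _ 1 1 _ n _ m _ _ 1 _ n]) auto
  have U: "C1 * ?U2 = C2"
    using blocks a by (intro eq_matI) (auto simp: C1 scalar_prod_def)
  have DU: "C3 * ?U2 + ?D = C4"
    using blocks by (intro eq_matI) auto
  have "det ?L = a"
    using blocks by (subst det_four_block_mat_upper_right_zero[of _ 1 _ m]) (auto simp: C1)
  moreover have "det ?U = 1"
    using U2 by (subst det_four_block_mat_lower_left_zero[of _ 1 _ n]) auto
  moreover have "C = ?L * ?M * ?U"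
    by (simp only: LM LMU U DU C_eq)
  moreover have "?L \<in> carrier_mat (1 + m) (1 + m)" "?U \<in> carrier_mat (1 + n) (1 + n)"
    using blocks by (intro four_block_carrier_mat; simp)+
  ultimately have "equivalent_mat (1 + m) (1 + n) C ?M"
    using a by (intro equivalent_matI[of ?L _ ?U]) simp_all
  with D show thesis
    by (rule that)
qed

lemma equivalent_mat_swap:
  fixes A :: "'a::field mat"
  assumes A: "A \<in> carrier_mat m n" and ij: "i < m" "j < n"
  obtains C where "C \<in> carrier_mat m n" "C $$ (0, 0) = A $$ (i, j)" "equivalent_mat m n A C"
proof -
  let ?C = "mat m n (\<lambda>(k, l). A $$ (if k = 0 then i else if k = i then 0 else k,
    if l = 0 then j else if l = j then 0 else l))"
  let ?P = "swaprows_mat m 0 i :: 'a mat" and ?Q = "swaprows_mat n 0 j :: 'a mat"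
  show thesis
  proof (rule that)
    show "?C \<in> carrier_mat m n" "?C $$ (0, 0) = A $$ (i, j)"
      using ij by auto
    \<comment> \<open>A swap is an involution, so its determinant squares to 1.\<close>
    have unit: "det (swaprows_mat k 0 l :: 'a mat) \<noteq> 0" if "l < k" for k l
    proof -
      have "det (swaprows_mat k 0 l * swaprows_mat k 0 l :: 'a mat) = 1"
        using that by (simp add: swaprows_mat_inv)
      then show ?thesis
        by (auto simp: det_mult[OF swaprows_mat_carrier swaprows_mat_carrier])
    qed
    have "?P * ?C = swaprows 0 i ?C"
      using ij by (intro swaprows_mat[symmetric]) auto
    moreover have "\<dots> * ?Q = swapcols 0 j (swaprows 0 i ?C)"
      using ij by (intro swapcols_mat[symmetric]) auto
    moreover have "swapcols 0 j (swaprows 0 i ?C) = A"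
      using A ij by (intro eq_matI) auto
    ultimately show "equivalent_mat m n A ?C"
      using ij by (intro equivalent_matI[of ?P _ ?Q] unit) auto
  qed
qed

text \<open>Gaussian elimination by induction on the rows: move a nonzero entry to the corner, split
  it off, and recurse on the Schur complement. A zero matrix ends the process with r = 0.\<close>

lemma equivalent_mat_diag_ones:
  fixes A :: "'a::field mat"
  assumes "A \<in> carrier_mat m n"
  shows "\<exists>r. r \<le> m \<and> r \<le> n \<and> equivalent_mat m n A (diag_ones m n r)"
  using assms
proof (induction m arbitrary: n A)
  case 0
  then have "A = diag_ones 0 n 0"
    by (intro eq_matI) (auto simp: diag_ones_def)
  then show ?case
    using equivalent_mat_refl[OF 0] by auto
next
  case (Suc m)
  show ?case
  proof (cases "A = diag_ones (Suc m) n 0")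
    case True
    then show ?thesis
      using equivalent_mat_refl[OF Suc.prems] by (intro exI[of _ 0]) simp
  next
    case False
    then obtain i j where ij: "i < Suc m" "j < n" "A $$ (i, j) \<noteq> 0"
      using Suc.prems by (auto simp: diag_ones_def mat_eq_iff)
    then obtain n' where n: "n = 1 + n'"
      by (cases n) auto
    have A: "A \<in> carrier_mat (1 + m) (1 + n')" and i: "i < 1 + m" and j: "j < 1 + n'"
      using Suc.prems ij by (simp_all add: n)
    obtain C where C: "C \<in> carrier_mat (1 + m) (1 + n')" "C $$ (0, 0) = A $$ (i, j)"
      "equivalent_mat (1 + m) (1 + n') A C"
      by (rule equivalent_mat_swap[OF A i j])
    have "C $$ (0, 0) \<noteq> 0"
      using C(2) ij(3) by simp
    then obtain D where D: "D \<in> carrier_mat m n'"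
      "equivalent_mat (1 + m) (1 + n') C (four_block_mat (1\<^sub>m 1) (0\<^sub>m 1 n') (0\<^sub>m m 1) D)"
      by (rule equivalent_mat_schur[OF C(1)])
    obtain r where r: "r \<le> m" "r \<le> n'" "equivalent_mat m n' D (diag_ones m n' r)"
      using Suc.IH[OF D(1)] by blast
    have "equivalent_mat (1 + m) (1 + n') (four_block_mat (1\<^sub>m 1) (0\<^sub>m 1 n') (0\<^sub>m m 1) D)
        (diag_ones (1 + m) (1 + n') (1 + r))"
      using equivalent_mat_block[OF r(3)] by (simp only: four_block_diag_ones diag_ones_carrier)
    then have "equivalent_mat (1 + m) (1 + n') A (diag_ones (1 + m) (1 + n') (1 + r))"
      using equivalent_mat_trans C(3) D diag_ones_carrier
      by (metis four_block_carrier_mat one_carrier_mat)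
    then show ?thesis
      using r by (intro exI[of _ "1 + r"]) (simp add: n)
  qed
qed

lemma det_nonzero_inverse:
  fixes P :: "'a::field mat"
  assumes "P \<in> carrier_mat k k" "det P \<noteq> 0"
  obtains P' where "P' \<in> carrier_mat k k" "P * P' = 1\<^sub>m k" "P' * P = 1\<^sub>m k"
  using det_non_zero_imp_unit[OF assms, of "()"] by (auto simp: Units_def ring_mat_def)

section \<open>From the rank of the full square matrix to its upper right block\<close>

lemma rank_upper_right_block_le:
  fixes X Y :: "'a::field mat"
  assumes X: "X \<in> carrier_mat m k" and Y: "Y \<in> carrier_mat k n"
  shows "vec_space.rank (m + n) (four_block_mat (0\<^sub>m m m) (X * Y) (0\<^sub>m n m) (0\<^sub>m n n)) \<le> k"
proof -
  \<comment> \<open>The blocks of width or height 0 merely complete the four-block pattern, so that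
    the inner dimension stays k.\<close>
  let ?X = "four_block_mat X (0\<^sub>m m 0) (0\<^sub>m n k) (0\<^sub>m n 0)"
  let ?Y = "four_block_mat (0\<^sub>m k m) Y (0\<^sub>m 0 m) (0\<^sub>m 0 n)"
  have "?X * ?Y = four_block_mat (0\<^sub>m m m) (X * Y) (0\<^sub>m n m) (0\<^sub>m n n)"
    using X Y by (subst mult_four_block_mat[of _ m k _ 0 _ n _ _ m _ n]) auto
  moreover have "?X \<in> carrier_mat (m + n) k" "?Y \<in> carrier_mat k (m + n)"
    using X Y by auto
  ultimately show ?thesis
    using rank_mult_le_inner[of ?X "m + n" k ?Y] by simp
qed

lemma upper_right_block_factorization:
  fixes b :: "'a::field mat"
  assumes b: "b \<in> carrier_mat m n"
    and r: "r = vec_space.rank (m + n) (four_block_mat (0\<^sub>m m m) b (0\<^sub>m n m) (0\<^sub>m n n))"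
  obtains X Y where "X \<in> carrier_mat m r" "Y \<in> carrier_mat r n" "b = X * Y"
proof -
  let ?B = "four_block_mat (0\<^sub>m m m) b (0\<^sub>m n m) (0\<^sub>m n n)"
  have "?B \<in> carrier_mat (m + n) (m + n)"
    using b by simp
  then obtain X Y where X: "X \<in> carrier_mat (m + n) r" and Y: "Y \<in> carrier_mat r (m + n)"
    and B: "?B = X * Y"
    unfolding r by (rule rank_factorization)
  \<comment> \<open>The first m rows of \<open>X\<close> and the last n columns of \<open>Y\<close>
    suffice; the shift by m skips the zero columns left of \<open>b\<close>.\<close>
  have "b = mat m r (\<lambda>(i, l). X $$ (i, l)) * mat r n (\<lambda>(l, j). Y $$ (l, m + j))"
  proof (rule eq_matI)
    fix i j assume "i < dim_row (mat m r (\<lambda>(i, l). X $$ (i, l)) * mat r n (\<lambda>(l, j). Y $$ (l, m + j)))"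
      "j < dim_col (mat m r (\<lambda>(i, l). X $$ (i, l)) * mat r n (\<lambda>(l, j). Y $$ (l, m + j)))"
    then have ij: "i < m" "j < n"
      by auto
    then have "b $$ (i, j) = ?B $$ (i, m + j)"
      using b by simp
    then show "b $$ (i, j) = (mat m r (\<lambda>(i, l). X $$ (i, l)) * mat r n (\<lambda>(l, j). Y $$ (l, m + j))) $$ (i, j)"
      unfolding B using ij X Y by (simp add: scalar_prod_def)
  qed (use b in auto)
  then show thesis
    by (intro that[of "mat m r (\<lambda>(i, l). X $$ (i, l))" "mat r n (\<lambda>(l, j). Y $$ (l, m + j))"]) auto
qed

lemma mult_assoc_middle:
  assumes "A \<in> carrier_mat k1 k2" "C \<in> carrier_mat k2 k3" "D \<in> carrier_mat k3 k4" "E \<in> carrier_mat k4 k5"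
  shows "A * (C * D) * E = (A * C) * (D * E)"
  using assms by (simp add: assoc_mult_mat[of _ k1 k2 _ k4 _ k5] assoc_mult_mat[of _ k2 k3 _ k4 _ k5]
      assoc_mult_mat[of _ k1 k2 _ k3 _ k5])

text \<open>Elimination yields some number k of ones. A factorization of \<open>b\<close> through
  dimension k bounds r by k, and one through dimension r makes the k x k identity factor through r,
  which bounds k by r.\<close>

lemma upper_right_block_normal_form:
  fixes b :: "'a::field mat"
  assumes b: "b \<in> carrier_mat m n"
    and r: "r = vec_space.rank (m + n) (four_block_mat (0\<^sub>m m m) b (0\<^sub>m n m) (0\<^sub>m n n))"
  shows "r \<le> m \<and> r \<le> n \<and> equivalent_mat m n b (diag_ones m n r)"
proof -
  obtain k where k: "k \<le> m" "k \<le> n" "equivalent_mat m n b (diag_ones m n k)"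
    using equivalent_mat_diag_ones[OF b] by blast
  then obtain P Q where PQ: "P \<in> carrier_mat m m" "Q \<in> carrier_mat n n" "det P \<noteq> 0" "det Q \<noteq> 0"
    and b_eq: "b = P * diag_ones m n k * Q"
    unfolding equivalent_mat_def by blast
  have "b = (P * diag_ones m k k) * (diag_ones k n k * Q)"
  proof -
    have D: "diag_ones m n k = diag_ones m k k * diag_ones k n k"
      by (simp add: diag_ones_mult)
    show ?thesis
      unfolding b_eq D by (rule mult_assoc_middle[OF PQ(1) diag_ones_carrier diag_ones_carrier PQ(2)])
  qed
  then have "r \<le> k"
    unfolding r using PQ
    by (metis rank_upper_right_block_le mult_carrier_mat diag_ones_carrier)
  moreover have "k \<le> r"
  proof -
    obtain X Y where XY: "X \<in> carrier_mat m r" "Y \<in> carrier_mat r n" "b = X * Y"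
      using upper_right_block_factorization[OF b r] by blast
    obtain P' where P': "P' \<in> carrier_mat m m" "P' * P = 1\<^sub>m m"
      using det_nonzero_inverse[OF PQ(1,3)] by metis
    obtain Q' where Q': "Q' \<in> carrier_mat n n" "Q * Q' = 1\<^sub>m n"
      using det_nonzero_inverse[OF PQ(2,4)] by metis
    let ?D = "diag_ones m n k" and ?E = "diag_ones k m k" and ?F = "diag_ones n k k"
    have "P' * b * Q' = P' * (P * (?D * Q)) * Q'"
      by (simp only: b_eq assoc_mult_mat[OF PQ(1) diag_ones_carrier PQ(2)])
    also have "\<dots> = (P' * P) * ((?D * Q) * Q')"
      by (rule mult_assoc_middle[OF P'(1) PQ(1) mult_carrier_mat[OF diag_ones_carrier PQ(2)] Q'(1)])
    also have "(?D * Q) * Q' = ?D"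
      by (simp only: assoc_mult_mat[OF diag_ones_carrier PQ(2) Q'(1)] Q'(2) right_mult_one_mat[OF diag_ones_carrier])
    also have "(P' * P) * ?D = ?D"
      by (simp only: P'(2) left_mult_one_mat[OF diag_ones_carrier])
    finally have "?D = P' * b * Q'" ..
    \<comment> \<open>\<open>?E\<close> and \<open>?F\<close> cut out the leading k x k corner of
      the normal form.\<close>
    moreover have "?E * ?D * ?F = 1\<^sub>m k"
      using k by (simp add: diag_ones_mult diag_ones_self)
    ultimately have "1\<^sub>m k = ?E * (P' * (X * Y) * Q') * ?F"
      using XY(3) by metis
    also have "P' * (X * Y) * Q' = (P' * X) * (Y * Q')"
      by (rule mult_assoc_middle[OF P'(1) XY(1,2) Q'(1)])
    also have "?E * ((P' * X) * (Y * Q')) * ?F = (?E * (P' * X)) * ((Y * Q') * ?F)"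
      by (rule mult_assoc_middle[OF diag_ones_carrier mult_carrier_mat[OF P'(1) XY(1)]
            mult_carrier_mat[OF XY(2) Q'(1)] diag_ones_carrier])
    also have "(Y * Q') * ?F = Y * (Q' * ?F)"
      by (rule assoc_mult_mat[OF XY(2) Q'(1) diag_ones_carrier])
    finally have "1\<^sub>m k = (?E * (P' * X)) * (Y * (Q' * ?F))" .
    moreover have "?E * (P' * X) \<in> carrier_mat k r" "Y * (Q' * ?F) \<in> carrier_mat r k"
      by (rule mult_carrier_mat[OF diag_ones_carrier mult_carrier_mat[OF P'(1) XY(1)]],
          rule mult_carrier_mat[OF XY(2) mult_carrier_mat[OF Q'(1) diag_ones_carrier]])
    ultimately have "vec_space.rank k (1\<^sub>m k :: 'a mat) \<le> r"
      using rank_mult_le_inner by metis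
    moreover have "vec_space.rank k (1\<^sub>m k :: 'a mat) = k"
      by (rule vec_space.low_rank_det_zero) auto
    ultimately show ?thesis
      by simp
  qed
  ultimately show ?thesis
    using k by (metis le_antisym)
qed

section \<open>Isomorphisms of Lie algebras\<close>

lemma lie_isoD:
  assumes "f \<in> lie_iso K L M"
  shows "x \<in> carrier L \<Longrightarrow> f x \<in> carrier M"
    and "x \<in> carrier L \<Longrightarrow> y \<in> carrier L \<Longrightarrow> f (x \<oplus>\<^bsub>L\<^esub> y) = f x \<oplus>\<^bsub>M\<^esub> f y"
    and "a \<in> carrier K \<Longrightarrow> x \<in> carrier L \<Longrightarrow> f (a \<odot>\<^bsub>L\<^esub> x) = a \<odot>\<^bsub>M\<^esub> f x"
    and "bij_betw f (carrier L) (carrier M)"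
    and "x \<in> carrier L \<Longrightarrow> y \<in> carrier L \<Longrightarrow> f (lie_bracket L x y) = lie_bracket M (f x) (f y)"
  using assms by (auto simp: lie_iso_def LinearCombinations.module_hom_def)

lemma lie_isoI:
  assumes "bij_betw f (carrier L) (carrier M)"
    and "\<And>x y. x \<in> carrier L \<Longrightarrow> y \<in> carrier L \<Longrightarrow> f (x \<oplus>\<^bsub>L\<^esub> y) = f x \<oplus>\<^bsub>M\<^esub> f y"
    and "\<And>a x. a \<in> carrier K \<Longrightarrow> x \<in> carrier L \<Longrightarrow> f (a \<odot>\<^bsub>L\<^esub> x) = a \<odot>\<^bsub>M\<^esub> f x"
    and "\<And>x y. x \<in> carrier L \<Longrightarrow> y \<in> carrier L \<Longrightarrow> f (lie_bracket L x y) = lie_bracket M (f x) (f y)"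
  shows "f \<in> lie_iso K L M"
  using assms bij_betwE[OF assms(1)] by (auto simp: lie_iso_def LinearCombinations.module_hom_def)

lemma lie_isomorphic_trans:
  assumes "lie_isomorphic K L M" "lie_isomorphic K M N"
  shows "lie_isomorphic K L N"
proof -
  obtain f g where f: "f \<in> lie_iso K L M" and g: "g \<in> lie_iso K M N"
    using assms by (auto simp: lie_isomorphic_def)
  have "g \<circ> f \<in> lie_iso K L N"
    by (rule lie_isoI) (use lie_isoD[OF f] lie_isoD[OF g] bij_betw_trans in auto)
  then show ?thesis
    by (auto simp: lie_isomorphic_def)
qed

text \<open>Equations are pulled back through the injectivity of \<open>f\<close>, for which closure
  of the domain is enough; this makes it directly applicable to \<open>trunc_lie\<close>.\<close>

lemma lie_iso_inv_into:
  assumes f: "f \<in> lie_iso K L M"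
    and add: "\<And>x y. x \<in> carrier L \<Longrightarrow> y \<in> carrier L \<Longrightarrow> x \<oplus>\<^bsub>L\<^esub> y \<in> carrier L"
    and smult: "\<And>a x. a \<in> carrier K \<Longrightarrow> x \<in> carrier L \<Longrightarrow> a \<odot>\<^bsub>L\<^esub> x \<in> carrier L"
    and bracket: "\<And>x y. x \<in> carrier L \<Longrightarrow> y \<in> carrier L \<Longrightarrow> lie_bracket L x y \<in> carrier L"
  shows "inv_into (carrier L) f \<in> lie_iso K M L"
proof (rule lie_isoI)
  let ?g = "inv_into (carrier L) f"
  note bij = lie_isoD(4)[OF f]
  show "bij_betw ?g (carrier M) (carrier L)"
    by (rule bij_betw_inv_into[OF bij])
  have g: "?g x \<in> carrier L" "f (?g x) = x" if "x \<in> carrier M" for x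
    using that bij by (metis bij_betw_imp_surj_on inv_into_into, metis bij_betw_inv_into_right)
  have eq: "?g y = x" if "x \<in> carrier L" "f x = y" for x y
    using that bij by (metis bij_betw_inv_into_left)
  show "?g (x \<oplus>\<^bsub>M\<^esub> y) = ?g x \<oplus>\<^bsub>L\<^esub> ?g y" if "x \<in> carrier M" "y \<in> carrier M" for x y
    using that by (intro eq add g) (simp_all only: lie_isoD(2)[OF f g(1) g(1)] g(2))
  show "?g (a \<odot>\<^bsub>M\<^esub> x) = a \<odot>\<^bsub>L\<^esub> ?g x" if "a \<in> carrier K" "x \<in> carrier M" for a x
    using that by (intro eq smult g) (simp_all only: lie_isoD(3)[OF f _ g(1)] g(2))
  show "?g (lie_bracket M x y) = lie_bracket L (?g x) (?g y)" if "x \<in> carrier M" "y \<in> carrier M" for x y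
    using that by (intro eq bracket g) (simp_all only: lie_isoD(5)[OF f g(1) g(1)] g(2))
qed

lemma lie_isomorphic_sym:
  assumes "lie_algebra K L" "lie_isomorphic K L M"
  shows "lie_isomorphic K M L"
proof -
  interpret lie_algebra K L
    by fact
  show ?thesis
    using assms(2) lie_iso_inv_into[where L = L] bracket_closed
    unfolding lie_isomorphic_def by blast
qed

section \<open>The derived bracket in normal form\<close>

definition trunc_lie :: "nat \<Rightarrow> nat \<Rightarrow> nat \<Rightarrow> ('k::field, nat \<times> nat \<Rightarrow> 'k) lie_algebra" where
  "trunc_lie m n r =
     \<lparr>carrier = supp_fun (grid m n), mult = (\<lambda>u v x. u x * v x), one = (\<lambda>x. 1), zero = (\<lambda>x. 0),
      add = (\<lambda>u v x. u x + v x), smult = (\<lambda>a u x. a * u x), lie_bracket = trunc_bracket r\<rparr>"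

lemma trunc_lie_simps [simp]:
  "carrier (trunc_lie m n r) = supp_fun (grid m n)"
  "u \<oplus>\<^bsub>trunc_lie m n r\<^esub> v = (\<lambda>x. u x + v x)"
  "a \<odot>\<^bsub>trunc_lie m n r\<^esub> u = (\<lambda>x. a * u x)"
  "lie_bracket (trunc_lie m n r) = trunc_bracket r"
  by (simp_all add: trunc_lie_def)

lemma trunc_lie_isomorphic_imp_eq:
  assumes "r \<le> m" "r \<le> n" "1 \<le> r" "s \<le> p" "s \<le> q" "1 \<le> s"
    and "lie_isomorphic class_ring (trunc_lie m n r :: ('k::field_char_0, _) lie_algebra) (trunc_lie p q s)"
  shows "r = s \<and> {m, n} = {p, q}"
proof -
  let ?L = "trunc_lie m n r :: ('k, _) lie_algebra" and ?M = "trunc_lie p q s :: ('k, _) lie_algebra"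
  obtain F where F: "F \<in> lie_iso class_ring ?L ?M"
    using assms(7) by (auto simp: lie_isomorphic_def)
  define G where "G = inv_into (carrier ?L) F"
  have G: "G \<in> lie_iso class_ring ?M ?L"
    unfolding G_def
  proof (rule lie_iso_inv_into[OF F])
    show "lie_bracket ?L x y \<in> carrier ?L" if "x \<in> carrier ?L" "y \<in> carrier ?L" for x y
      using that trunc_bracket_mem[OF assms(1,2)] by simp
  qed (auto simp: supp_fun_def)
  note F' = lie_isoD[OF F, simplified] and G' = lie_isoD[OF G, simplified]
  have "trunc_iso m n r p q s F G"
  proof
    show "linear_on_supp (grid m n) F" "linear_on_supp (grid p q) G"
      unfolding linear_on_supp_def by (intro conjI ballI allI F' G'; assumption)+
    show "G (F u) = u" if "u \<in> supp_fun (grid m n)" for u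
      using that F'(4) unfolding G_def by (simp add: bij_betw_inv_into_left)
    show "F (G u) = u" if "u \<in> supp_fun (grid p q)" for u
      using that F'(4) unfolding G_def by (simp add: bij_betw_inv_into_right)
  qed (use assms F' G' in auto)
  then show ?thesis
    by (rule trunc_iso.parameters_eq)
qed

text \<open>Transposition reverses products and so turns the bracket into its negative. The sign of
  \<open>T\<close> cancels inside each product but survives outside the bracket, which repairs this;
  \<open>T\<close> is its own inverse.\<close>

lemma trunc_lie_transpose:
  "lie_isomorphic class_ring (trunc_lie m n r :: ('k::field, _) lie_algebra) (trunc_lie n m r)"
proof -
  define T :: "(nat \<times> nat \<Rightarrow> 'k) \<Rightarrow> nat \<times> nat \<Rightarrow> 'k" where "T u = (\<lambda>(i, j). - u (j, i))" for u
  have "T \<in> lie_iso class_ring (trunc_lie m n r) (trunc_lie n m r)"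
  proof (rule lie_isoI)
    show "bij_betw T (carrier (trunc_lie m n r)) (carrier (trunc_lie n m r))"
      by (rule bij_betw_byWitness[where f' = T]) (auto simp: T_def supp_fun_def grid_def)
  qed (auto simp: T_def trunc_bracket_def fun_eq_iff sum_negf[symmetric] algebra_simps intro!: sum.cong)
  then show ?thesis
    by (auto simp: lie_isomorphic_def)
qed

lemma trunc_bracket_mat:
  assumes r: "r \<le> m" "r \<le> n" and Y: "Y \<in> carrier_mat n m" and Z: "Z \<in> carrier_mat n m"
    and ij: "i < n" "j < m"
  shows "(Y * diag_ones m n r * Z) $$ (i, j) = (\<Sum>l<r. Y $$ (i, l) * Z $$ (l, j))"
proof -
  have YD: "(Y * diag_ones m n r) $$ (i, l) = (if l < r then Y $$ (i, l) else 0)" if "l < n" for l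
  proof -
    have "(Y * diag_ones m n r) $$ (i, l) = (\<Sum>k = 0..<m. Y $$ (i, k) * (if k = l \<and> k < r then 1 else 0))"
      using that ij Y by (simp add: diag_ones_def scalar_prod_def)
    also have "\<dots> = (\<Sum>k = 0..<m. if k = l then (if l < r then Y $$ (i, l) else 0) else 0)"
      by (rule sum.cong) auto
    finally show ?thesis
      using r by simp
  qed
  have "(Y * diag_ones m n r * Z) $$ (i, j) = (\<Sum>l = 0..<n. (Y * diag_ones m n r) $$ (i, l) * Z $$ (l, j))"
    using ij Y Z by (simp add: scalar_prod_def diag_ones_def)
  also have "\<dots> = (\<Sum>l = 0..<n. if l < r then Y $$ (i, l) * Z $$ (l, j) else 0)"
    by (intro sum.cong refl) (simp add: YD)
  also have "\<dots> = (\<Sum>l<r. Y $$ (i, l) * Z $$ (l, j))"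
    using r by (intro sum.mono_neutral_cong_right) auto
  finally show ?thesis .
qed

text \<open>The default 0 places the result in \<open>supp_fun (grid m n)\<close>; matrix entries
  beyond the dimensions are unspecified.\<close>

definition mat_entries :: "nat \<Rightarrow> nat \<Rightarrow> 'k::field mat \<Rightarrow> nat \<times> nat \<Rightarrow> 'k" where
  "mat_entries m n Y = (\<lambda>(i, j). if i < n \<and> j < m then Y $$ (i, j) else 0)"

lemma mat_entries_mem: "mat_entries m n Y \<in> supp_fun (grid m n)"
  by (auto simp: mat_entries_def supp_fun_def grid_def)

lemma mat_entries_bracket:
  assumes r: "r \<le> m" "r \<le> n" and Y: "Y \<in> carrier_mat n m" and Z: "Z \<in> carrier_mat n m"
  shows "mat_entries m n (Y * diag_ones m n r * Z - Z * diag_ones m n r * Y) =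
    trunc_bracket r (mat_entries m n Y) (mat_entries m n Z)"
proof (rule ext)
  fix x :: "nat \<times> nat"
  obtain i j where x: "x = (i, j)"
    by (cases x)
  show "mat_entries m n (Y * diag_ones m n r * Z - Z * diag_ones m n r * Y) x =
    trunc_bracket r (mat_entries m n Y) (mat_entries m n Z) x"
  proof (cases "x \<in> grid m n")
    case True
    then have ij: "i < n" "j < m"
      by (auto simp: x grid_def)
    have "mat_entries m n (Y * diag_ones m n r * Z - Z * diag_ones m n r * Y) x =
        (Y * diag_ones m n r * Z) $$ (i, j) - (Z * diag_ones m n r * Y) $$ (i, j)"
      using ij Y Z by (simp add: x mat_entries_def del: assoc_mult_mat)
    also have "\<dots> = (\<Sum>l<r. Y $$ (i, l) * Z $$ (l, j)) - (\<Sum>l<r. Z $$ (i, l) * Y $$ (l, j))"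
      by (simp only: trunc_bracket_mat[OF r Y Z ij] trunc_bracket_mat[OF r Z Y ij])
    finally show ?thesis
      using ij r by (simp add: x trunc_bracket_def mat_entries_def sum_subtractf)
  next
    case False
    then show ?thesis
      by (simp only: supp_funD[OF mat_entries_mem False]
          supp_funD[OF trunc_bracket_mem[OF r mat_entries_mem mat_entries_mem] False])
  qed
qed

lemma derived_lie_isomorphic_trunc:
  fixes B :: "'k::field mat"
  assumes B: "B \<in> gl_pos m n" and rank: "vec_space.rank (m + n) B = r"
  shows "r \<le> m \<and> r \<le> n \<and> lie_isomorphic class_ring (derived_lie_algebra m n B) (trunc_lie m n r)"
proof -
  obtain b where b: "b \<in> carrier_mat m n"
    and B_eq: "B = four_block_mat (0\<^sub>m m m) b (0\<^sub>m n m) (0\<^sub>m n n)"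
    using B unfolding gl_pos_def mem_Collect_eq by (elim exE conjE)
  have r: "r \<le> m" "r \<le> n" and "equivalent_mat m n b (diag_ones m n r)"
    using upper_right_block_normal_form[OF b] rank unfolding B_eq by blast+
  then obtain P Q where P: "P \<in> carrier_mat m m" "det P \<noteq> 0" and Q: "Q \<in> carrier_mat n n" "det Q \<noteq> 0"
    and b_eq: "b = P * diag_ones m n r * Q"
    unfolding equivalent_mat_def by blast
  obtain P' where P': "P' \<in> carrier_mat m m" "P * P' = 1\<^sub>m m" "P' * P = 1\<^sub>m m"
    using det_nonzero_inverse[OF P] .
  obtain Q' where Q': "Q' \<in> carrier_mat n n" "Q * Q' = 1\<^sub>m n" "Q' * Q = 1\<^sub>m n"
    using det_nonzero_inverse[OF Q] .
  let ?ll = "lower_left m n :: 'k mat \<Rightarrow> 'k mat"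
  let ?L = "derived_lie_algebra m n B" and ?M = "trunc_lie m n r :: ('k, _) lie_algebra"
  let ?entries = "mat_entries m n :: 'k mat \<Rightarrow> _"
  \<comment> \<open>Row m is where the lower left block starts. \<open>Q\<close> and
    \<open>P\<close> change sides compared with \<open>b\<close>, since c has the transposed
    shape.\<close>
  define \<phi> :: "'k mat \<Rightarrow> nat \<times> nat \<Rightarrow> 'k"
    where "\<phi> X = ?entries (Q * mat n m (\<lambda>(i, j). X $$ (m + i, j)) * P)" for X
  define \<psi> :: "(nat \<times> nat \<Rightarrow> 'k) \<Rightarrow> 'k mat" where "\<psi> u = ?ll (Q' * mat n m u * P')" for u
  have \<phi>_ll: "\<phi> (?ll c) = ?entries (Q * c * P)" if "c \<in> carrier_mat n m" for c
  proof -
    have "mat n m (\<lambda>(i, j). ?ll c $$ (m + i, j)) = c"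
      using that by (intro eq_matI) auto
    then show ?thesis
      by (simp add: \<phi>_def)
  qed
  have entries_mat: "?entries (mat n m u) = u" if "u \<in> supp_fun (grid m n)" for u
    using that by (auto simp: mat_entries_def supp_fun_def grid_def)
  have mat_entries_inverse: "mat n m (?entries Y) = Y" if "Y \<in> carrier_mat n m" for Y
    using that by (auto simp: mat_entries_def)
  have carrier: "carrier ?L = ?ll ` carrier_mat n m"
    by (auto simp: derived_lie_algebra_def gl_neg_def)
  have QcP [simp]: "Q * c * P \<in> carrier_mat n m" if "c \<in> carrier_mat n m" for c
    using that P Q by auto
  have conj: "S * (T * c * U) * V = (S * T) * c * (U * V)"
    if "S \<in> carrier_mat n n" "T \<in> carrier_mat n n" "c \<in> carrier_mat n m"
      "U \<in> carrier_mat m m" "V \<in> carrier_mat m m" for S T c U V :: "'k mat"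
    using that by (simp add: assoc_mult_mat[of _ n n _ n _ m] assoc_mult_mat[of _ n n _ m _ m]
        assoc_mult_mat[of _ n m _ m _ m])
  have "\<phi> \<in> lie_iso class_ring ?L ?M"
  proof (rule lie_isoI)
    show "bij_betw \<phi> (carrier ?L) (carrier ?M)"
    proof (rule bij_betw_byWitness[where f' = \<psi>])
      show "\<forall>X\<in>carrier ?L. \<psi> (\<phi> X) = X"
      proof
        fix X assume "X \<in> carrier ?L"
        then obtain c where c: "c \<in> carrier_mat n m" "X = ?ll c"
          by (auto simp: carrier)
        have "Q' * (Q * c * P) * P' = (Q' * Q) * c * (P * P')"
          by (rule conj[OF Q'(1) Q(1) c(1) P(1) P'(1)])
        then show "\<psi> (\<phi> X) = X"
          using c by (simp add: \<psi>_def \<phi>_ll mat_entries_inverse P' Q')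
      qed
      show "\<forall>u\<in>carrier ?M. \<phi> (\<psi> u) = u"
      proof
        fix u assume u: "u \<in> carrier ?M"
        let ?c = "mat n m u"
        have c: "?c \<in> carrier_mat n m"
          by simp
        have "Q * (Q' * ?c * P') * P = (Q * Q') * ?c * (P' * P)"
          by (rule conj[OF Q(1) Q'(1) c P'(1) P(1)])
        moreover have "Q' * ?c * P' \<in> carrier_mat n m"
          using P'(1) Q'(1) by auto
        ultimately show "\<phi> (\<psi> u) = u"
          using u by (simp add: \<psi>_def \<phi>_ll entries_mat P' Q')
      qed
      show "\<phi> ` carrier ?L \<subseteq> carrier ?M"
        by (auto simp: \<phi>_def mat_entries_mem)
      have "Q' * mat n m u * P' \<in> carrier_mat n m" for u
        using P'(1) Q'(1) by auto
      then show "\<psi> ` carrier ?M \<subseteq> carrier ?L"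
        by (auto simp: \<psi>_def carrier)
    qed
  next
    fix X Y assume "X \<in> carrier ?L" "Y \<in> carrier ?L"
    then obtain c d where c: "c \<in> carrier_mat n m" "X = ?ll c" and d: "d \<in> carrier_mat n m" "Y = ?ll d"
      by (auto simp: carrier)
    have "X \<oplus>\<^bsub>?L\<^esub> Y = ?ll (c + d)"
      using c d by (auto simp: derived_lie_algebra_def)
    moreover have "Q * (c + d) * P = Q * c * P + Q * d * P"
      using P Q c d by (simp add: mult_add_distrib_mat[of Q n n c m d] add_mult_distrib_mat[of "Q * c" n m "Q * d" P m])
    ultimately show "\<phi> (X \<oplus>\<^bsub>?L\<^esub> Y) = \<phi> X \<oplus>\<^bsub>?M\<^esub> \<phi> Y"
      using P Q c d by (auto simp: \<phi>_ll mat_entries_def fun_eq_iff)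
    have "lie_bracket ?L X Y = ?ll (c * b * d - d * b * c)"
      using derived_bracket_blocks[OF b c(1) d(1)] by (simp add: derived_lie_algebra_def B_eq c d)
    moreover have "Q * (c * b * d - d * b * c) * P =
        (Q * c * P) * diag_ones m n r * (Q * d * P) - (Q * d * P) * diag_ones m n r * (Q * c * P)"
    proof -
      \<comment> \<open>The factors \<open>P\<close> and \<open>Q\<close> inside b complete the
        outer \<open>Q * c\<close> and \<open>d * P\<close> to the images of c and d, leaving only
        the normal form between them.\<close>
      have expand: "Q * (c * (P * D * Q) * d) * P = (Q * c * P) * D * (Q * d * P)"
        if "c \<in> carrier_mat n m" "d \<in> carrier_mat n m" "D \<in> carrier_mat m n" for c d D
        using that P(1) Q(1)
        by (simp add: assoc_mult_mat[of _ n n _ n _ m] assoc_mult_mat[of _ n n _ m _ m]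
            assoc_mult_mat[of _ n m _ m _ m] assoc_mult_mat[of _ n m _ m _ n] assoc_mult_mat[of _ n m _ n _ m]
            assoc_mult_mat[of _ m m _ n _ n] assoc_mult_mat[of _ m m _ n _ m] assoc_mult_mat[of _ m n _ n _ m]
            assoc_mult_mat[of _ m m _ m _ m] assoc_mult_mat[of _ m n _ m _ m])
      have "Q * (c * b * d) * P = (Q * c * P) * diag_ones m n r * (Q * d * P)"
        "Q * (d * b * c) * P = (Q * d * P) * diag_ones m n r * (Q * c * P)"
        unfolding b_eq by (rule expand[OF c(1) d(1) diag_ones_carrier], rule expand[OF d(1) c(1) diag_ones_carrier])
      moreover have "c * b * d \<in> carrier_mat n m" "d * b * c \<in> carrier_mat n m"
        using b c d by auto
      moreover have "Q * (S - T) * P = Q * S * P - Q * T * P"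
        if "S \<in> carrier_mat n m" "T \<in> carrier_mat n m" for S T
        using P Q that by (simp add: mult_minus_distrib_mat[of Q n n S m T]
            minus_mult_distrib_mat[of "Q * S" n m "Q * T" P m])
      ultimately show ?thesis
        by (simp only:)
    qed
    moreover have "c * b * d - d * b * c \<in> carrier_mat n m"
      using b c d by auto
    ultimately have "\<phi> (lie_bracket ?L X Y) = ?entries ((Q * c * P) * diag_ones m n r * (Q * d * P)
        - (Q * d * P) * diag_ones m n r * (Q * c * P))"
      by (simp only: \<phi>_ll)
    also have "\<dots> = trunc_bracket r (?entries (Q * c * P)) (?entries (Q * d * P))"
      by (rule mat_entries_bracket[OF r QcP[OF c(1)] QcP[OF d(1)]])
    finally show "\<phi> (lie_bracket ?L X Y) = lie_bracket ?M (\<phi> X) (\<phi> Y)"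
      by (simp only: \<phi>_ll c d trunc_lie_simps)
  next
    fix a X assume "X \<in> carrier ?L"
    then obtain c where c: "c \<in> carrier_mat n m" "X = ?ll c"
      by (auto simp: carrier)
    have "a \<odot>\<^bsub>?L\<^esub> X = ?ll (a \<cdot>\<^sub>m c)"
      using c by (auto simp: derived_lie_algebra_def)
    moreover have "Q * (a \<cdot>\<^sub>m c) * P = a \<cdot>\<^sub>m (Q * c * P)"
      using P Q c by (simp add: mult_smult_distrib[of Q n n c m] mult_smult_assoc_mat[of "Q * c" n m P m])
    ultimately show "\<phi> (a \<odot>\<^bsub>?L\<^esub> X) = a \<odot>\<^bsub>?M\<^esub> \<phi> X"
      using P Q c by (auto simp: \<phi>_ll mat_entries_def fun_eq_iff)
  qed
  then show ?thesis
    using r by (auto simp: lie_isomorphic_def)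
qed

section \<open>Classification by size and rank\<close>

theorem theorem6:
  fixes m n p q r1 r2 :: nat
    and B H :: "'k::field_char_0 mat"
  assumes "m \<ge> 1" "n \<ge> 1" "p \<ge> 1" "q \<ge> 1"
    and "B \<in> gl_pos m n" and "H \<in> gl_pos p q"
    and "vec_space.rank (m + n) B = r1" and "r1 \<ge> 1"
    and "vec_space.rank (p + q) H = r2" and "r2 \<ge> 1"
  shows "lie_isomorphic class_ring (derived_lie_algebra m n B) (derived_lie_algebra p q H)
    \<longleftrightarrow> r1 = r2 \<and> {m, n} = {p, q}"
proof -
  let ?L = "derived_lie_algebra m n B" and ?M = "derived_lie_algebra p q H"
  let ?TL = "trunc_lie m n r1 :: ('k, _) lie_algebra" and ?TM = "trunc_lie p q r2 :: ('k, _) lie_algebra"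
  have L: "r1 \<le> m" "r1 \<le> n" "lie_isomorphic class_ring ?L ?TL"
    using derived_lie_isomorphic_trunc[OF assms(5,7)] by blast+
  have M: "r2 \<le> p" "r2 \<le> q" "lie_isomorphic class_ring ?M ?TM"
    using derived_lie_isomorphic_trunc[OF assms(6,9)] by blast+
  \<comment> \<open>Symmetry is applied with the derived algebra as domain, where the Lie algebra
    axioms supply closure.\<close>
  have L': "lie_isomorphic class_ring ?TL ?L"
    by (rule lie_isomorphic_sym[OF lie_algebra_derived_lie_algebra[OF assms(5)] L(3)])
  have M': "lie_isomorphic class_ring ?TM ?M"
    by (rule lie_isomorphic_sym[OF lie_algebra_derived_lie_algebra[OF assms(6)] M(3)])
  show ?thesis
  proof
    assume "lie_isomorphic class_ring ?L ?M"
    then have "lie_isomorphic class_ring ?TL ?TM"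
      by (intro lie_isomorphic_trans[OF lie_isomorphic_trans[OF L'] M(3)])
    then show "r1 = r2 \<and> {m, n} = {p, q}"
      by (rule trunc_lie_isomorphic_imp_eq[OF L(1,2) assms(8) M(1,2) assms(10)])
  next
    assume eq: "r1 = r2 \<and> {m, n} = {p, q}"
    then consider "p = m" "q = n" | "p = n" "q = m"
      by (auto simp: doubleton_eq_iff)
    then have "lie_isomorphic class_ring ?L ?TM"
    proof cases
      case 1
      then show ?thesis
        using L(3) eq by simp
    next
      case 2
      then show ?thesis
        using lie_isomorphic_trans[OF L(3) trunc_lie_transpose] eq by simp
    qed
    then show "lie_isomorphic class_ring ?L ?M"
      by (rule lie_isomorphic_trans[OF _ M'])
  qed
qed

end
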